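(* Suppose that for every $\epsilon>0$ and every integer $T_0\ge1$ there is an algorithm $A_{\epsilon,T_0}$ which, on any instance of Multistage Knapsack with at most $T_0$ time steps, outputs a feasible solution of value at least $(1-\epsilon)$ times the optimum in time $O(n^{f(\epsilon,T_0)})$ for some function $f$. Then algorithm $PTAS_{MK}$ (described in the context) is a polynomial time approximation scheme for Multistage Knapsack with an arbitrary number $T$ of time steps: for every fixed $\epsilon>0$ it runs in time polynomial in the input size and outputs a feasible solution of value at least $(1-\epsilon)$ times the optimal value.
   Context: Multistage Knapsack: given a time horizon $T\ge 1$, objects $N=\{1,\dots,n\}$, for each $t\in\{1,\dots,T\}$ and $i\in N$ a profit $p_{ti}$ and a weight $w_{ti}$, for each $t\in\{1,\dots,T-1\}$ and $i\in N$ a bonus $B_{ti}\ge0$, and capacities $C_t$. A solution is a sequence $S=(S_1,\dots,S_T)$ of subsets of $N$ with $\sum_{i\in S_t}w_{ti}\le C_t$ for all $t$; its value is $\sum_{t=1}^T\sum_{i\in S_t}p_{ti}+\sum_{t=1}^{T-1}\sum_{i\in\Delta_t}B_{ti}$, where $\Delta_t=(S_t\cap S_{t+1})\cup(\overline{S_t}\cap\overline{S_{t+1}})$; it is to be maximized. Restricting the instance to a set of consecutive time steps (keeping profits, weights, capacities of those steps and bonuses between consecutive steps inside the set) gives a Multistage Knapsack instance. Algorithm $PTAS_{MK}$ on input $\epsilon>0$: let $\epsilon'=\epsilon/2$ and $T_0=\lceil 1/\epsilon'\rceil$; for integers $t$ let $\mathcal I_t=\{t,\dots,t+T_0-1\}\cap\{1,\dots,T\}$,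 considered whenever nonempty. For each $t\in\{1,\dots,T_0\}$: apply $A_{\epsilon',T_0}$ to the subinstance on each nonempty interval $\mathcal I_{t'}$ with $t'\equiv t\pmod{T_0}$ (these intervals partition $\{1,\dots,T\}$), and let $S^t$ be the concatenation of the obtained partial solutions. Output the best of $S^1,\dots,S^{T_0}$. *)

theory Defs
  imports Complex_Main
begin

section \<open>Multistage Knapsack\<close>

text \<open>
  Time steps are \<open>1, \<dots>, horizon I\<close> and objects are \<open>1, \<dots>, nobj I\<close>; the values of the
  functions outside these ranges (for \<open>bonus\<close>: outside the steps \<open>1, \<dots>, horizon I - 1\<close>)
  are irrelevant.  Numbers are rational.
\<close>

record mk_inst =
  horizon :: nat
  nobj :: nat
  capacity :: "nat \<Rightarrow> rat"
  profit :: "nat \<Rightarrow> nat \<Rightarrow> rat"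
  weight :: "nat \<Rightarrow> nat \<Rightarrow> rat"
  bonus :: "nat \<Rightarrow> nat \<Rightarrow> rat"

definition objects :: "mk_inst \<Rightarrow> nat set" where
  "objects I = {1..nobj I}"

text \<open>
  Weights and capacities are nonnegative, as usual for knapsack problems, so that a feasible
  solution (the empty one) exists.  Profits may have any sign.
\<close>

definition mk_instance :: "mk_inst \<Rightarrow> bool" where
  "mk_instance I \<longleftrightarrow> 1 \<le> horizon I \<and> 1 \<le> nobj I
     \<and> (\<forall>t\<in>{1..horizon I}. 0 \<le> capacity I t \<and> (\<forall>i\<in>objects I. 0 \<le> weight I t i))
     \<and> (\<forall>t\<in>{1..<horizon I}. \<forall>i\<in>objects I. 0 \<le> bonus I t i)"

type_synonym solution = "nat \<Rightarrow> nat set"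

definition selection :: "mk_inst \<Rightarrow> solution \<Rightarrow> bool" where
  "selection I S \<longleftrightarrow> (\<forall>t\<in>{1..horizon I}. S t \<subseteq> objects I)"

definition feasible :: "mk_inst \<Rightarrow> solution \<Rightarrow> bool" where
  "feasible I S \<longleftrightarrow> selection I S
     \<and> (\<forall>t\<in>{1..horizon I}. (\<Sum>i\<in>S t. weight I t i) \<le> capacity I t)"

definition Delta :: "mk_inst \<Rightarrow> solution \<Rightarrow> nat \<Rightarrow> nat set" where
  "Delta I S t = (S t \<inter> S (t + 1)) \<union> ((objects I - S t) \<inter> (objects I - S (t + 1)))"

definition mk_value :: "mk_inst \<Rightarrow> solution \<Rightarrow> rat" where
  "mk_value I S = (\<Sum>t\<in>{1..horizon I}. \<Sum>i\<in>S t. profit I t i)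
     + (\<Sum>t\<in>{1..<horizon I}. \<Sum>i\<in>Delta I S t. bonus I t i)"

text \<open>The set of values below is finite, since a value depends only on steps up to the horizon.\<close>

definition mk_opt :: "mk_inst \<Rightarrow> rat" where
  "mk_opt I = Max {mk_value I S | S. feasible I S}"

text \<open>
  The restriction to a set \<open>J\<close> of consecutive time steps, renumbered so that it starts at
  step 1.  A solution \<open>S\<close> of \<open>I\<close> induces on it the partial solution \<open>shift_sol J S\<close>.
\<close>

definition subinstance :: "mk_inst \<Rightarrow> nat set \<Rightarrow> mk_inst" where
  "subinstance I J = I\<lparr> horizon := card J,
     capacity := (\<lambda>s. capacity I (Min J + s - 1)),
     profit := (\<lambda>s. profit I (Min J + s - 1)),
     weight := (\<lambda>s. weight I (Min J + s - 1)),
     bonus := (\<lambda>s. bonus I (Min J + s - 1)) \<rparr>"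

definition shift_sol :: "nat set \<Rightarrow> solution \<Rightarrow> solution" where
  "shift_sol J S = (\<lambda>s. S (Min J + s - 1))"


section \<open>Algorithms and running times\<close>

text \<open>
  Algorithms are programs of a first-order functional language over rational numbers and cons
  cells.  Every elementary operation (arithmetic on rationals, comparison, construction and
  inspection of a cell, branching, function call) costs one time unit.  The running time of an
  algorithm on \<open>n\<close> objects and boundedly many steps can be bounded in terms of \<open>n\<close> alone only
  if the cost of arithmetic does not depend on the magnitude of the numbers.
\<close>

datatype val = Null | Num rat | Cell val val

datatype oper = Plus | Minus | Times | Divide | Leq | IsCell | Cons | Head | Tail

text \<open>
  \<open>Call f es\<close> calls the function named \<open>f\<close> of the current program; \<open>Use Q es\<close> runs
  the self-contained program \<open>Q\<close> as a subroutine.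
\<close>

datatype expr =
    Var string
  | Lit val
  | Op oper "expr list"
  | Cond expr expr expr
  | Call string "expr list"
  | Use "(string \<times> string list \<times> expr) list" "expr list"

text \<open>
  A program is a list of function definitions (name, parameters, body).  The first one is
  the entry point.
\<close>

type_synonym prog = "(string \<times> string list \<times> expr) list"

text \<open>Booleans are represented by the numbers 1 and 0.  Ill-typed operations yield \<open>Null\<close>.\<close>

fun arith_op :: "(rat \<Rightarrow> rat \<Rightarrow> rat) \<Rightarrow> val list \<Rightarrow> val" where
  "arith_op g [Num a, Num b] = Num (g a b)"
| "arith_op g _ = Null"

fun apply_op :: "oper \<Rightarrow> val list \<Rightarrow> val" where
  "apply_op Plus vs = arith_op (+) vs"
| "apply_op Minus vs = arith_op (-) vs"
| "apply_op Times vs = arith_op (*) vs"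
| "apply_op Divide vs = arith_op (/) vs"
| "apply_op Leq vs = arith_op (\<lambda>a b. if a \<le> b then 1 else 0) vs"
| "apply_op IsCell vs = (case vs of [Cell a b] \<Rightarrow> Num 1 | [u] \<Rightarrow> Num 0 | _ \<Rightarrow> Null)"
| "apply_op Cons vs = (case vs of [a, b] \<Rightarrow> Cell a b | _ \<Rightarrow> Null)"
| "apply_op Head vs = (case vs of [Cell a b] \<Rightarrow> a | _ \<Rightarrow> Null)"
| "apply_op Tail vs = (case vs of [Cell a b] \<Rightarrow> b | _ \<Rightarrow> Null)"

text \<open>
  \<open>eval P env e v \<tau>\<close>: in program \<open>P\<close> and environment \<open>env\<close>, evaluation of \<open>e\<close>
  terminates with result \<open>v\<close> after \<open>\<tau>\<close> time units; \<open>evals\<close> is the analogue for argument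
  lists.
\<close>

inductive eval :: "prog \<Rightarrow> (string \<rightharpoonup> val) \<Rightarrow> expr \<Rightarrow> val \<Rightarrow> nat \<Rightarrow> bool"
  and evals :: "prog \<Rightarrow> (string \<rightharpoonup> val) \<Rightarrow> expr list \<Rightarrow> val list \<Rightarrow> nat \<Rightarrow> bool" where
  eval_Var: "env x = Some v \<Longrightarrow> eval P env (Var x) v 1"
| eval_Lit: "eval P env (Lit v) v 1"
| eval_Op: "evals P env es vs \<tau> \<Longrightarrow> eval P env (Op oper es) (apply_op oper vs) (\<tau> + 1)"
| eval_Cond_True: "eval P env c u \<tau>1 \<Longrightarrow> u \<noteq> Num 0 \<Longrightarrow> eval P env e1 v \<tau>2
    \<Longrightarrow> eval P env (Cond c e1 e2) v (\<tau>1 + \<tau>2 + 1)"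
| eval_Cond_False: "eval P env c (Num 0) \<tau>1 \<Longrightarrow> eval P env e2 v \<tau>2
    \<Longrightarrow> eval P env (Cond c e1 e2) v (\<tau>1 + \<tau>2 + 1)"
| eval_Call: "evals P env es vs \<tau>1 \<Longrightarrow> map_of P f = Some (xs, e) \<Longrightarrow> length xs = length vs
    \<Longrightarrow> eval P (map_of (zip xs vs)) e v \<tau>2 \<Longrightarrow> eval P env (Call f es) v (\<tau>1 + \<tau>2 + 1)"
| eval_Use: "evals P env es vs \<tau>1 \<Longrightarrow> Q = (f, xs, e) # R \<Longrightarrow> length xs = length vs
    \<Longrightarrow> eval Q (map_of (zip xs vs)) e v \<tau>2 \<Longrightarrow> eval P env (Use Q es) v (\<tau>1 + \<tau>2 + 1)"
| evals_Nil: "evals P env [] [] 0"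
| evals_Cons: "eval P env e v \<tau>1 \<Longrightarrow> evals P env es vs \<tau>2
    \<Longrightarrow> evals P env (e # es) (v # vs) (\<tau>1 + \<tau>2)"

definition exec :: "prog \<Rightarrow> val \<Rightarrow> val \<Rightarrow> nat \<Rightarrow> bool" where
  "exec P u v \<tau> \<longleftrightarrow> (\<exists>f x e R. P = (f, [x], e) # R \<and> eval P [x \<mapsto> u] e v \<tau>)"

inductive_cases eval_VarE: "eval P env (Var x) v \<tau>"
inductive_cases eval_LitE: "eval P env (Lit u) v \<tau>"
inductive_cases eval_OpE: "eval P env (Op oper es) v \<tau>"
inductive_cases eval_CondE: "eval P env (Cond c e1 e2) v \<tau>"
inductive_cases eval_CallE: "eval P env (Call f es) v \<tau>"
inductive_cases eval_UseE: "eval P env (Use Q es) v \<tau>"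
inductive_cases evals_NilE: "evals P env [] vs \<tau>"
inductive_cases evals_ConsE: "evals P env (e # es) vs \<tau>"

lemma eval_deterministic:
  "eval P env e v \<tau> \<Longrightarrow> (\<forall>v' \<tau>'. eval P env e v' \<tau>' \<longrightarrow> v' = v \<and> \<tau>' = \<tau>)"
  "evals P env es vs \<tau> \<Longrightarrow> (\<forall>vs' \<tau>'. evals P env es vs' \<tau>' \<longrightarrow> vs' = vs \<and> \<tau>' = \<tau>)"
proof (induction rule: eval_evals.inducts)
  case eval_Var
  then show ?case by (auto elim: eval_VarE)
next
  case eval_Lit
  then show ?case by (auto elim: eval_LitE)
next
  case (eval_Op P env es vs \<tau> oper)
  show ?case
  proof (intro allI impI)
    fix v' \<tau>'
    assume "eval P env (Op oper es) v' \<tau>'"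
    then show "v' = apply_op oper vs \<and> \<tau>' = \<tau> + 1"
    proof (rule eval_OpE)
      fix vs' \<tau>1'
      assume *: "v' = apply_op oper vs'" "\<tau>' = Suc \<tau>1'" "evals P env es vs' \<tau>1'"
      from eval_Op.IH *(3) have "vs' = vs \<and> \<tau>1' = \<tau>" by blast
      then show ?thesis using *(1,2) by simp
    qed
  qed
next
  case (eval_Cond_True P env c u \<tau>1 e1 v \<tau>2 e2)
  show ?case
  proof (intro allI impI)
    fix v' \<tau>'
    assume "eval P env (Cond c e1 e2) v' \<tau>'"
    then show "v' = v \<and> \<tau>' = \<tau>1 + \<tau>2 + 1"
    proof (rule eval_CondE)
      fix u' \<tau>1' \<tau>2'
      assume *: "\<tau>' = Suc (\<tau>1' + \<tau>2')" "eval P env c u' \<tau>1'" "eval P env e1 v' \<tau>2'"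
      have "\<tau>1' = \<tau>1" using eval_Cond_True.IH(1) *(2) by blast
      moreover have "v' = v \<and> \<tau>2' = \<tau>2" using eval_Cond_True.IH(2) *(3) by blast
      ultimately show ?thesis using *(1) by simp
    next
      fix \<tau>1' \<tau>2'
      assume "eval P env c (Num 0) \<tau>1'"
      then have "Num 0 = u" using eval_Cond_True.IH(1) by blast
      then show ?thesis using eval_Cond_True.hyps(2) by blast
    qed
  qed
next
  case (eval_Cond_False P env c \<tau>1 e2 v \<tau>2 e1)
  show ?case
  proof (intro allI impI)
    fix v' \<tau>'
    assume "eval P env (Cond c e1 e2) v' \<tau>'"
    then show "v' = v \<and> \<tau>' = \<tau>1 + \<tau>2 + 1"
    proof (rule eval_CondE)
      fix u' \<tau>1' \<tau>2'
      assume *: "eval P env c u' \<tau>1'" "u' \<noteq> Num 0"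
      have "u' = Num 0" using eval_Cond_False.IH(1) *(1) by blast
      then show ?thesis using *(2) by blast
    next
      fix \<tau>1' \<tau>2'
      assume *: "\<tau>' = Suc (\<tau>1' + \<tau>2')" "eval P env c (Num 0) \<tau>1'" "eval P env e2 v' \<tau>2'"
      have "\<tau>1' = \<tau>1" using eval_Cond_False.IH(1) *(2) by blast
      moreover have "v' = v \<and> \<tau>2' = \<tau>2" using eval_Cond_False.IH(2) *(3) by blast
      ultimately show ?thesis using *(1) by simp
    qed
  qed
next
  case (eval_Call P env es vs \<tau>1 f xs e v \<tau>2)
  show ?case
  proof (intro allI impI)
    fix v' \<tau>'
    assume "eval P env (Call f es) v' \<tau>'"
    then show "v' = v \<and> \<tau>' = \<tau>1 + \<tau>2 + 1"
    proof (rule eval_CallE)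
      fix vs' \<tau>1' xs' e' \<tau>2'
      assume *: "\<tau>' = Suc (\<tau>1' + \<tau>2')" "evals P env es vs' \<tau>1'"
        "map_of P f = Some (xs', e')" "eval P (map_of (zip xs' vs')) e' v' \<tau>2'"
      from eval_Call.IH(1) *(2) have "vs' = vs \<and> \<tau>1' = \<tau>1" by blast
      moreover from eval_Call.hyps *(3) have "xs' = xs \<and> e' = e" by simp
      ultimately have "v' = v \<and> \<tau>2' = \<tau>2 \<and> \<tau>1' = \<tau>1" using eval_Call.IH(2) *(4) by blast
      then show ?thesis using *(1) by simp
    qed
  qed
next
  case (eval_Use P env es vs \<tau>1 Q f xs e R v \<tau>2)
  show ?case
  proof (intro allI impI)
    fix v' \<tau>'
    assume "eval P env (Use Q es) v' \<tau>'"
    then obtain vs' \<tau>1' f' xs' e' R' \<tau>2' where *: "\<tau>' = Suc (\<tau>1' + \<tau>2')"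
      "evals P env es vs' \<tau>1'" "Q = (f', xs', e') # R'"
      "eval Q (map_of (zip xs' vs')) e' v' \<tau>2'"
      using eval_UseE by metis
    from eval_Use.IH(1) *(2) have "vs' = vs \<and> \<tau>1' = \<tau>1" by blast
    moreover from eval_Use.hyps *(3) have "xs' = xs \<and> e' = e" by simp
    ultimately have "v' = v \<and> \<tau>2' = \<tau>2 \<and> \<tau>1' = \<tau>1" using eval_Use.IH(2) *(4) by blast
    then show "v' = v \<and> \<tau>' = \<tau>1 + \<tau>2 + 1" using *(1) by simp
  qed
next
  case evals_Nil
  then show ?case by (auto elim: evals_NilE)
next
  case (evals_Cons P env e v \<tau>1 es vs \<tau>2)
  show ?case
  proof (intro allI impI)
    fix vs' \<tau>'
    assume "evals P env (e # es) vs' \<tau>'"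
    then show "vs' = v # vs \<and> \<tau>' = \<tau>1 + \<tau>2"
    proof (rule evals_ConsE)
      fix v' \<tau>1' ws \<tau>2'
      assume *: "vs' = v' # ws" "\<tau>' = \<tau>1' + \<tau>2'" "eval P env e v' \<tau>1'" "evals P env es ws \<tau>2'"
      have "v' = v \<and> \<tau>1' = \<tau>1" using evals_Cons.IH(1) *(3) by blast
      moreover have "ws = vs \<and> \<tau>2' = \<tau>2" using evals_Cons.IH(2) *(4) by blast
      ultimately show ?thesis using *(1,2) by simp
    qed
  qed
qed

lemma exec_deterministic: "exec P u v \<tau> \<Longrightarrow> exec P u v' \<tau>' \<Longrightarrow> v' = v \<and> \<tau>' = \<tau>"
proof -
  assume "exec P u v \<tau>" and "exec P u v' \<tau>'"
  then obtain f x e R g y e' R' where "P = (f, [x], e) # R" and 1: "eval P [x \<mapsto> u] e v \<tau>"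
    and "P = (g, [y], e') # R'" and 2: "eval P [y \<mapsto> u] e' v' \<tau>'"
    unfolding exec_def by blast
  then have "y = x" "e' = e" by simp_all
  with 1 2 show ?thesis using eval_deterministic(1) by blast
qed


subsection \<open>Input and output format\<close>

fun list_val :: "val list \<Rightarrow> val" where
  "list_val [] = Null"
| "list_val (v # vs) = Cell v (list_val vs)"

definition row_val :: "mk_inst \<Rightarrow> (nat \<Rightarrow> rat) \<Rightarrow> val" where
  "row_val I r = list_val (map (\<lambda>i. Num (r i)) [1..<nobj I + 1])"

definition step_val :: "mk_inst \<Rightarrow> nat \<Rightarrow> val" where
  "step_val I t =
     Cell (Num (capacity I t)) (Cell (row_val I (profit I t)) (row_val I (weight I t)))"

definition inst_val :: "mk_inst \<Rightarrow> val" where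
  "inst_val I = Cell (list_val (map (step_val I) [1..<horizon I + 1]))
     (list_val (map (\<lambda>t. row_val I (bonus I t)) [1..<horizon I]))"

definition sol_val :: "mk_inst \<Rightarrow> solution \<Rightarrow> val" where
  "sol_val I S = list_val
     (map (\<lambda>t. row_val I (\<lambda>i. if i \<in> S t then 1 else 0)) [1..<horizon I + 1])"

text \<open>
  Input size is the number of cells and atoms; it is at most a constant times the length of any
  encoding in which every number takes at least one symbol.
\<close>

fun val_size :: "val \<Rightarrow> nat" where
  "val_size Null = 1"
| "val_size (Num a) = 1"
| "val_size (Cell u v) = 1 + val_size u + val_size v"

definition outputs :: "prog \<Rightarrow> mk_inst \<Rightarrow> solution \<Rightarrow> nat \<Rightarrow> bool" where
  "outputs P I S \<tau> \<longleftrightarrow> selection I S \<and> exec P (inst_val I) (sol_val I S) \<tau>"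


section \<open>The approximation scheme\<close>

text \<open>
  The result of the scheme, given the subroutine \<open>Q\<close> for at most \<open>T0\<close> steps:
  \<open>window I T0 t\<close> is \<open>\<I>\<^sub>t\<close>, \<open>concat_sol Q T0 I t S\<close> says that \<open>S\<close> is \<open>S\<^sup>t\<close>, and
  \<open>best_concat Q T0 I S\<close> that \<open>S\<close> is a best one among \<open>S\<^sup>1, S\<^sup>2, \<dots>\<close> up to index \<open>T0\<close>.
\<close>

definition window :: "mk_inst \<Rightarrow> nat \<Rightarrow> int \<Rightarrow> nat set" where
  "window I T0 t = {s. t \<le> int s \<and> int s \<le> t + int T0 - 1 \<and> 1 \<le> s \<and> s \<le> horizon I}"

definition concat_sol :: "prog \<Rightarrow> nat \<Rightarrow> mk_inst \<Rightarrow> nat \<Rightarrow> solution \<Rightarrow> bool" where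
  "concat_sol Q T0 I t S \<longleftrightarrow>
     (\<forall>t'. t' mod int T0 = int t mod int T0 \<and> window I T0 t' \<noteq> {} \<longrightarrow>
        (\<exists>\<tau>. outputs Q (subinstance I (window I T0 t')) (shift_sol (window I T0 t') S) \<tau>))"

definition best_concat :: "prog \<Rightarrow> nat \<Rightarrow> mk_inst \<Rightarrow> solution \<Rightarrow> bool" where
  "best_concat Q T0 I S \<longleftrightarrow>
     (\<exists>Ss. (\<forall>t\<in>{1..T0}. concat_sol Q T0 I t (Ss t))
        \<and> (\<exists>t\<in>{1..T0}. S = Ss t \<and> (\<forall>t'\<in>{1..T0}. mk_value I (Ss t') \<le> mk_value I S)))"

text \<open>
  The program.  The variables \<open>st\<close> and \<open>bo\<close> hold the list of steps and the list of bonus rows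
  of an instance; these have lengths \<open>T\<close> and \<open>T - 1\<close>, whence \<open>k - 1\<close> bonus rows
  for a block of \<open>k\<close> steps.  Solutions are lists of 0-1 rows.
\<close>

abbreviation "nil \<equiv> Lit Null"
abbreviation "num q \<equiv> Lit (Num q)"
abbreviation "cons_of e1 e2 \<equiv> Op Cons [e1, e2]"
abbreviation "head_of e \<equiv> Op Head [e]"
abbreviation "tail_of e \<equiv> Op Tail [e]"
abbreviation "nonempty e \<equiv> Op IsCell [e]"
abbreviation "leq e1 e2 \<equiv> Op Leq [e1, e2]"
abbreviation "plus_of e1 e2 \<equiv> Op Plus [e1, e2]"
abbreviation "times_of e1 e2 \<equiv> Op Times [e1, e2]"
abbreviation "pred_of e \<equiv> Op Minus [e, num 1]"

definition list_funs :: prog where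
  "list_funs =
   [(''take'', [''k'', ''xs''],
       Cond (leq (Var ''k'') (num 0)) nil
         (Cond (nonempty (Var ''xs''))
           (cons_of (head_of (Var ''xs''))
              (Call ''take'' [pred_of (Var ''k''), tail_of (Var ''xs'')]))
           nil)),
    (''drop'', [''k'', ''xs''],
       Cond (leq (Var ''k'') (num 0)) (Var ''xs'')
         (Cond (nonempty (Var ''xs''))
           (Call ''drop'' [pred_of (Var ''k''), tail_of (Var ''xs'')])
           nil)),
    (''append'', [''xs'', ''ys''],
       Cond (nonempty (Var ''xs''))
         (cons_of (head_of (Var ''xs'')) (Call ''append'' [tail_of (Var ''xs''), Var ''ys'']))
         (Var ''ys''))]"

text \<open>
  \<open>profit ps x\<close> and \<open>bonus bs x y\<close> are the profit of the 0-1 row \<open>x\<close> and the bonus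
  between the consecutive 0-1 rows \<open>x\<close> and \<open>y\<close>; \<open>value st bo sol\<close> is the value of
  the solution \<open>sol\<close>.
\<close>

definition value_funs :: prog where
  "value_funs =
   [(''profit'', [''ps'', ''x''],
       Cond (nonempty (Var ''ps''))
         (plus_of (times_of (head_of (Var ''ps'')) (head_of (Var ''x'')))
            (Call ''profit'' [tail_of (Var ''ps''), tail_of (Var ''x'')]))
         (num 0)),
    (''bonus'', [''bs'', ''x'', ''y''],
       Cond (nonempty (Var ''bs''))
         (plus_of
            (Cond (head_of (Var ''x''))
               (Cond (head_of (Var ''y'')) (head_of (Var ''bs'')) (num 0))
               (Cond (head_of (Var ''y'')) (num 0) (head_of (Var ''bs''))))
            (Call ''bonus'' [tail_of (Var ''bs''), tail_of (Var ''x''), tail_of (Var ''y'')]))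
         (num 0)),
    (''value'', [''st'', ''bo'', ''sol''],
       Cond (nonempty (Var ''st''))
         (plus_of
            (Call ''profit'' [head_of (tail_of (head_of (Var ''st''))), head_of (Var ''sol'')])
            (plus_of
               (Cond (nonempty (Var ''bo''))
                  (Call ''bonus'' [head_of (Var ''bo''), head_of (Var ''sol''),
                                   head_of (tail_of (Var ''sol''))])
                  (num 0))
               (Call ''value'' [tail_of (Var ''st''), tail_of (Var ''bo''), tail_of (Var ''sol'')])))
         (num 0))]"

text \<open>
  \<open>blocks k st bo\<close> applies \<open>Q\<close> to the first \<open>k\<close> steps and then to blocks of \<open>T0\<close> steps
  each (the last one may be shorter), and concatenates the results.  Thus \<open>candidate t st bo\<close>
  is \<open>S\<^sup>t\<close>: its first block consists of the steps \<open>1, \<dots>, t - 1\<close>, and is absent for \<open>t = 1\<close>.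
  \<open>best t st bo\<close> is a best one among \<open>S\<^sup>1, S\<^sup>2, \<dots>\<close> up to index \<open>t\<close>.
\<close>

definition ptas_prog :: "prog \<Rightarrow> nat \<Rightarrow> prog" where
  "ptas_prog Q T0 =
   [(''main'', [''inst''],
       Call ''best'' [num (of_nat T0), head_of (Var ''inst''), tail_of (Var ''inst'')]),
    (''best'', [''t'', ''st'', ''bo''],
       Cond (leq (Var ''t'') (num 1))
         (Call ''candidate'' [Var ''t'', Var ''st'', Var ''bo''])
         (Call ''better'' [Var ''st'', Var ''bo'',
            Call ''candidate'' [Var ''t'', Var ''st'', Var ''bo''],
            Call ''best'' [pred_of (Var ''t''), Var ''st'', Var ''bo'']])),
    (''better'', [''st'', ''bo'', ''sol'', ''sol2''],
       Cond (leq (Call ''value'' [Var ''st'', Var ''bo'', Var ''sol2''])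
                 (Call ''value'' [Var ''st'', Var ''bo'', Var ''sol'']))
         (Var ''sol'') (Var ''sol2'')),
    (''candidate'', [''t'', ''st'', ''bo''],
       Cond (leq (Var ''t'') (num 1))
         (Call ''blocks'' [num (of_nat T0), Var ''st'', Var ''bo''])
         (Call ''blocks'' [pred_of (Var ''t''), Var ''st'', Var ''bo''])),
    (''blocks'', [''k'', ''st'', ''bo''],
       Cond (nonempty (Var ''st''))
         (Call ''append''
            [Use Q [cons_of (Call ''take'' [Var ''k'', Var ''st''])
                            (Call ''take'' [pred_of (Var ''k''), Var ''bo''])],
             Call ''blocks'' [num (of_nat T0), Call ''drop'' [Var ''k'', Var ''st''],
                              Call ''drop'' [Var ''k'', Var ''bo'']]])
         nil)]
   @ value_funs @ list_funs"

definition eps' :: "real \<Rightarrow> real" where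
  "eps' \<epsilon> = \<epsilon> / 2"

definition block_len :: "real \<Rightarrow> nat" where
  "block_len \<epsilon> = nat \<lceil>1 / eps' \<epsilon>\<rceil>"

definition PTAS_MK :: "(real \<Rightarrow> nat \<Rightarrow> prog) \<Rightarrow> real \<Rightarrow> prog" where
  "PTAS_MK A \<epsilon> = ptas_prog (A (eps' \<epsilon>) (block_len \<epsilon>)) (block_len \<epsilon>)"

end

theory Submission
  imports Defs "HOL-Library.FuncSet"
begin

text \<open>
  Fix an optimal solution \<open>O\<close>.  Cutting the time line into the blocks of offset \<open>t\<close> loses exactly
  the bonuses of \<open>O\<close> at the cuts, and each step is a cut for exactly one of the \<open>T0\<close> offsets.
  The bonuses of \<open>O\<close> sum to at most the optimum, because the empty selection earns every bonus
  (this replaces nonnegativity of the profits).  Hence, on average over the offsets, the optima of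
  the blocks sum to at least \<open>1 - 1 / T0\<close> times the optimum, and the subroutine loses another
  factor \<open>1 - \<epsilon>'\<close>.
\<close>

section \<open>Decomposition into blocks\<close>

text \<open>The two losses are the reason for halving \<epsilon>: one share \<epsilon>' pays for the
  subroutine, the other for the cuts, since 1/\<open>T0\<close> \<le> \<epsilon>'. Returning from
  blocks to the whole instance costs nothing: the bonus at a cut depends on two independently
  computed partial solutions, but it is never negative. The obstacle is the bookkeeping between two
  descriptions of a block. The algorithm is specified by windows indexed by integers congruent to
  the offset, some of them nonpositive, whereas the program peels prefixes off two lists. They meet
  in the fact that the slices passed to the subroutine are exactly the encoding of the renumbered
  subinstance, so the hypothesis on the subroutine applies to them. For the running time only upper
  bounds are propagated. A block has the same objects as the whole instance, so one bound serves all
  subroutine calls, and each offset makes at most as many calls as there are steps.\<close>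

text \<open>Start of the block of offset \<open>t\<close> that contains step \<open>s\<close>; it is at most 0 if the first block is truncated.\<close>

definition block_of :: "nat \<Rightarrow> nat \<Rightarrow> nat \<Rightarrow> int" where
  "block_of T0 t s = int s - (int s - int t) mod int T0"

text \<open>The range of the quantifier in \<open>concat_sol\<close>, so that facts about its
  members transfer to \<open>concat_sol\<close> by unfolding.\<close>

definition block_starts :: "mk_inst \<Rightarrow> nat \<Rightarrow> nat \<Rightarrow> int set" where
  "block_starts I T0 t = {j. j mod int T0 = int t mod int T0 \<and> window I T0 j \<noteq> {}}"

abbreviation block :: "mk_inst \<Rightarrow> nat \<Rightarrow> int \<Rightarrow> mk_inst" where
  "block I T0 j \<equiv> subinstance I (window I T0 j)"

text \<open>Inverse of \<open>shift_sol\<close> on all blocks at once: the argument of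
  \<open>F j\<close> is the number of step \<open>s\<close> inside its block. It is counted from
  \<open>Min\<close> of the window and not from \<open>block_of\<close>, because the first block may
  be truncated.\<close>

definition glue :: "mk_inst \<Rightarrow> nat \<Rightarrow> nat \<Rightarrow> (int \<Rightarrow> solution) \<Rightarrow> solution" where
  "glue I T0 t F s = F (block_of T0 t s) (s + 1 - Min (window I T0 (block_of T0 t s)))"

definition step_profit :: "mk_inst \<Rightarrow> solution \<Rightarrow> nat \<Rightarrow> rat" where
  "step_profit I S t = (\<Sum>i\<in>S t. profit I t i)"

definition step_bonus :: "mk_inst \<Rightarrow> solution \<Rightarrow> nat \<Rightarrow> rat" where
  "step_bonus I S t = (\<Sum>i\<in>Delta I S t. bonus I t i)"

lemma mk_value_eq: "mk_value I S = sum (step_profit I S) {1..horizon I} + sum (step_bonus I S) {1..<horizon I}"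
  by (simp add: mk_value_def step_profit_def step_bonus_def)

lemma objects_subinstance [simp]: "objects (subinstance I J) = objects I"
  by (simp add: objects_def subinstance_def)

lemma horizon_subinstance [simp]: "horizon (subinstance I J) = card J"
  by (simp add: subinstance_def)

lemma nobj_subinstance [simp]: "nobj (subinstance I J) = nobj I"
  by (simp add: subinstance_def)

lemma Min_atLeastAtMost: "a \<le> b \<Longrightarrow> Min {a..b} = (a::nat)"
  by (intro Min_eqI) auto

lemma window_cases:
  assumes "window I T0 j \<noteq> {}"
  obtains a b where "window I T0 j = {a..b}" "1 \<le> a" "a \<le> b" "b \<le> horizon I"
proof -
  have eq: "window I T0 j = {max 1 (nat j)..min (horizon I) (nat (j + int T0 - 1))}"
  proof (rule set_eqI)
    fix s show "s \<in> window I T0 j \<longleftrightarrow> s \<in> {max 1 (nat j)..min (horizon I) (nat (j + int T0 - 1))}"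
      unfolding window_def by auto
  qed
  show ?thesis using that[OF eq] assms unfolding eq by auto
qed

lemma card_window_le: "card (window I T0 j) \<le> T0"
proof -
  have "int ` window I T0 j \<subseteq> {j..j + int T0 - 1}" unfolding window_def by auto
  then have "card (int ` window I T0 j) \<le> card {j..j + int T0 - 1}" by (intro card_mono) auto
  then show ?thesis by (simp add: card_image)
qed

text \<open>The distance from the start of a window to a member lies in [0, \<open>T0\<close>),
  hence equals its own residue, and starts congruent to \<open>t\<close> all give the residue of
  \<open>s - t\<close>. This is the partition property of the blocks: a step determines the only
  window of the given offset that contains it.\<close>

lemma mem_window_iff:
  assumes "T0 \<ge> 1" "j mod int T0 = int t mod int T0" "s \<in> {1..horizon I}"
  shows "s \<in> window I T0 j \<longleftrightarrow> block_of T0 t s = j"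
proof
  assume "s \<in> window I T0 j"
  then have "0 \<le> int s - j" "int s - j < int T0" unfolding window_def by auto
  then have "int s - j = (int s - j) mod int T0" by simp
  also have "\<dots> = (int s - int t) mod int T0" using assms(2) by (metis mod_diff_right_eq)
  finally show "block_of T0 t s = j" unfolding block_of_def by simp
next
  assume j: "block_of T0 t s = j"
  have "0 \<le> (int s - int t) mod int T0" "(int s - int t) mod int T0 < int T0" using assms(1) by simp_all
  then show "s \<in> window I T0 j" using assms(3) j unfolding window_def block_of_def by auto
qed

lemma block_of_mod: "block_of T0 t s mod int T0 = int t mod int T0"
proof -
  have "block_of T0 t s mod int T0 = (int s - (int s - int t)) mod int T0"
    unfolding block_of_def by (metis mod_diff_right_eq)
  then show ?thesis by simp
qed

lemma block_of_mem:
  assumes "T0 \<ge> 1" "s \<in> {1..horizon I}"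
  shows "s \<in> window I T0 (block_of T0 t s)"
  using mem_window_iff[OF assms(1) block_of_mod assms(2)] by blast

lemma block_starts_eq:
  assumes "T0 \<ge> 1"
  shows "block_starts I T0 t = block_of T0 t ` {1..horizon I}"
proof
  show "block_starts I T0 t \<subseteq> block_of T0 t ` {1..horizon I}"
  proof
    fix j assume j: "j \<in> block_starts I T0 t"
    then obtain s where s: "s \<in> window I T0 j" unfolding block_starts_def by blast
    then have "s \<in> {1..horizon I}" unfolding window_def by simp
    with s j show "j \<in> block_of T0 t ` {1..horizon I}"
      using mem_window_iff[OF assms, of j t s I] unfolding block_starts_def by blast
  qed
  show "block_of T0 t ` {1..horizon I} \<subseteq> block_starts I T0 t"
    using block_of_mem[OF assms] block_of_mod unfolding block_starts_def by fastforce
qed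

text \<open>From \<open>s\<close> to \<open>s + 1\<close> the residue of \<open>s - t\<close> either
  grows by one, and the start stays, or wraps to 0, which happens exactly when \<open>s + 1\<close>
  starts a block.\<close>

lemma block_of_Suc_eq_iff:
  assumes "T0 \<ge> 1"
  shows "block_of T0 t (s + 1) = block_of T0 t s \<longleftrightarrow> (int s + 1) mod int T0 \<noteq> int t mod int T0"
proof -
  let ?d = "(int s - int t) mod int T0" and ?d' = "(int s + 1 - int t) mod int T0"
  have T: "int T0 > 0" using assms by simp
  have b: "0 \<le> ?d" "?d < int T0" using T by simp_all
  have d': "?d' = (?d + 1) mod int T0" by (metis add.commute add_diff_eq mod_add_right_eq)
  have d'': "?d' = (if ?d + 1 = int T0 then 0 else ?d + 1)"
    unfolding d' using b by auto
  have "(int s + 1) mod int T0 = int t mod int T0 \<longleftrightarrow> ?d' = 0"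
    by (simp add: mod_eq_dvd_iff dvd_eq_mod_eq_0)
  moreover have "block_of T0 t (s + 1) = block_of T0 t s \<longleftrightarrow> ?d' = ?d + 1"
    unfolding block_of_def of_nat_add of_nat_1 by linarith
  ultimately show ?thesis using d'' b by auto
qed

section \<open>Restriction of an instance to an interval of steps\<close>

context
  fixes I :: mk_inst and J :: "nat set" and a b :: nat
  assumes J: "J = {a..b}" "1 \<le> a" "a \<le> b"
begin

lemma card_interval: "card J = b + 1 - a"
  using J by simp

lemma Min_interval: "Min J = a"
  using J Min_atLeastAtMost by simp

lemma step_profit_subinstance:
  "step_profit (subinstance I J) (shift_sol J S) s = step_profit I S (a + s - 1)"
  unfolding step_profit_def shift_sol_def subinstance_def Min_interval by simp

lemma step_bonus_subinstance:
  assumes "1 \<le> s"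
  shows "step_bonus (subinstance I J) (shift_sol J S) s = step_bonus I S (a + s - 1)"
proof -
  have "a + (s + 1) - 1 = a + s - 1 + 1" using assms by simp
  then have "Delta (subinstance I J) (shift_sol J S) s = Delta I S (a + s - 1)"
    unfolding Delta_def shift_sol_def Min_interval by (simp add: assms)
  then show ?thesis
    unfolding step_bonus_def subinstance_def Min_interval by simp
qed

lemma mk_value_subinstance:
  "mk_value (subinstance I J) (shift_sol J S)
    = sum (step_profit I S) {a..b} + sum (step_bonus I S) {a..<b}"
proof -
  have "sum (step_profit (subinstance I J) (shift_sol J S)) {1..card J} = sum (step_profit I S) {a..b}"
    by (rule sum.reindex_bij_witness[of _ "\<lambda>s. s + 1 - a" "\<lambda>s. a + s - 1"])
      (use J(2,3) in \<open>auto simp: step_profit_subinstance card_interval\<close>)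
  moreover have "sum (step_bonus (subinstance I J) (shift_sol J S)) {1..<card J} = sum (step_bonus I S) {a..<b}"
    by (rule sum.reindex_bij_witness[of _ "\<lambda>s. s + 1 - a" "\<lambda>s. a + s - 1"])
      (use J(2,3) in \<open>auto simp: step_bonus_subinstance card_interval\<close>)
  ultimately show ?thesis unfolding mk_value_eq by simp
qed

lemma feasible_subinstance:
  "feasible (subinstance I J) (shift_sol J S)
    \<longleftrightarrow> (\<forall>t\<in>{a..b}. S t \<subseteq> objects I \<and> (\<Sum>i\<in>S t. weight I t i) \<le> capacity I t)"
proof -
  have "(\<forall>s\<in>{1..card J}. P (a + s - 1)) \<longleftrightarrow> (\<forall>t\<in>{a..b}. P t)" for P
  proof
    assume *: "\<forall>s\<in>{1..card J}. P (a + s - 1)"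
    show "\<forall>t\<in>{a..b}. P t"
    proof
      fix t assume "t \<in> {a..b}"
      then have "t + 1 - a \<in> {1..card J}" "a + (t + 1 - a) - 1 = t" using J(2,3) by (auto simp: card_interval)
      then show "P t" using bspec[OF *, of "t + 1 - a"] by simp
    qed
  next
    assume *: "\<forall>t\<in>{a..b}. P t"
    show "\<forall>s\<in>{1..card J}. P (a + s - 1)"
    proof
      fix s assume "s \<in> {1..card J}"
      then have "a + s - 1 \<in> {a..b}" using J(2,3) by (auto simp: card_interval)
      then show "P (a + s - 1)" using * by blast
    qed
  qed
  from this[of "\<lambda>t. S t \<subseteq> objects I \<and> (\<Sum>i\<in>S t. weight I t i) \<le> capacity I t"] show ?thesis
    unfolding feasible_def selection_def objects_subinstance horizon_subinstance
    unfolding shift_sol_def Min_interval by (auto simp: subinstance_def Min_interval)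
qed

text \<open>This identifies the input of a subroutine call with list slices of the whole instance.
  The bonus slice stops before \<open>b\<close>, since the bonus between \<open>b\<close> and
  \<open>b + 1\<close> leaves the block.\<close>

lemma inst_val_subinstance:
  "inst_val (subinstance I J) = Cell (list_val (map (step_val I) [a..<b + 1]))
     (list_val (map (\<lambda>t. row_val I (bonus I t)) [a..<b]))"
proof -
  have row: "row_val (subinstance I J) r = row_val I r" for r unfolding row_val_def by simp
  have step: "step_val (subinstance I J) s = step_val I (a + s - 1)" for s
    unfolding step_val_def row by (simp add: subinstance_def Min_interval)
  have shift: "map (\<lambda>s. g (a + s - 1)) [1..<n - a + 1] = map g [a..<n]" if "a \<le> n" for g :: "nat \<Rightarrow> val" and n
    by (rule nth_equalityI) (use that in \<open>auto simp del: upt_Suc\<close>)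
  have "map (step_val (subinstance I J)) [1..<card J + 1] = map (step_val I) [a..<b + 1]"
    using shift[of "b + 1" "step_val I"] J unfolding step card_interval by simp
  moreover have "map (\<lambda>t. row_val (subinstance I J) (bonus (subinstance I J) t)) [1..<card J]
      = map (\<lambda>t. row_val I (bonus I t)) [a..<b]"
    using shift[of b "\<lambda>t. row_val I (bonus I t)"] J(2,3) unfolding row card_interval
    by (simp add: subinstance_def Min_interval Suc_diff_le del: upt_Suc)
  ultimately show ?thesis unfolding inst_val_def by simp
qed

lemma sol_val_subinstance:
  "sol_val (subinstance I J) (shift_sol J S)
    = list_val (map (\<lambda>t. row_val I (\<lambda>i. if i \<in> S t then 1 else 0)) [a..<b + 1])"
proof -
  have "map (\<lambda>t. row_val (subinstance I J) (\<lambda>i. if i \<in> shift_sol J S t then 1 else 0)) [1..<card J + 1]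
      = map (\<lambda>t. row_val I (\<lambda>i. if i \<in> S t then 1 else 0)) [a..<b + 1]"
    by (rule nth_equalityI) (use J(2,3) in \<open>auto simp: card_interval row_val_def shift_sol_def Min_interval simp del: upt_Suc\<close>)
  then show ?thesis unfolding sol_val_def by simp
qed

lemma mk_instance_subinstance:
  assumes "mk_instance I" "b \<le> horizon I"
  shows "mk_instance (subinstance I J)"
  unfolding mk_instance_def objects_subinstance horizon_subinstance nobj_subinstance
proof (intro conjI ballI)
  fix s
  {
    assume "s \<in> {1..card J}"
    then have "a + s - 1 \<in> {1..horizon I}" using J(2,3) assms(2) by (auto simp: card_interval)
    then show "0 \<le> capacity (subinstance I J) s"
      and "\<And>i. i \<in> objects I \<Longrightarrow> 0 \<le> weight (subinstance I J) s i"
      using assms(1) unfolding mk_instance_def by (simp_all add: subinstance_def Min_interval)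
  }
  {
    fix i assume "s \<in> {1..<card J}" "i \<in> objects I"
    moreover from this have "a + s - 1 \<in> {1..<horizon I}"
      using J(2,3) assms(2) by (auto simp: card_interval)
    ultimately show "0 \<le> bonus (subinstance I J) s i"
      using assms(1) unfolding mk_instance_def by (simp add: subinstance_def Min_interval)
  }
qed (use assms(1) J(2,3) in \<open>simp_all add: card_interval mk_instance_def\<close>)

end

section \<open>Gluing partial solutions, and the value as a sum over blocks\<close>

lemma mk_instance_block:
  assumes "mk_instance I" "window I T0 j \<noteq> {}"
  shows "mk_instance (block I T0 j)"
  using assms by (metis window_cases mk_instance_subinstance)

text \<open>\<open>glue\<close> reproduces a partial solution only on the steps of its block; this
  and the next two congruence rules absorb the arbitrary values elsewhere.\<close>

lemma mk_value_cong:
  assumes "\<And>s. s \<in> {1..horizon I} \<Longrightarrow> S s = S' s"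
  shows "mk_value I S = mk_value I S'"
  unfolding mk_value_def Delta_def using assms by (intro arg_cong2[where f = plus] sum.cong) auto

lemma feasible_cong:
  assumes "\<And>s. s \<in> {1..horizon I} \<Longrightarrow> S s = S' s"
  shows "feasible I S \<longleftrightarrow> feasible I S'"
  unfolding feasible_def selection_def using assms by auto

lemma outputs_cong:
  assumes "\<And>s. s \<in> {1..horizon I} \<Longrightarrow> S s = S' s"
  shows "outputs P I S \<tau> \<longleftrightarrow> outputs P I S' \<tau>"
proof -
  have "sol_val I S = sol_val I S'"
    unfolding sol_val_def using assms by (intro arg_cong[where f = list_val] map_cong) auto
  moreover have "selection I S \<longleftrightarrow> selection I S'"
    unfolding selection_def using assms by auto
  ultimately show ?thesis unfolding outputs_def by simp
qed

lemma shift_sol_glue: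
  assumes "T0 \<ge> 1" "j \<in> block_starts I T0 t" "s \<in> {1..card (window I T0 j)}"
  shows "shift_sol (window I T0 j) (glue I T0 t F) s = F j s"
proof -
  obtain a b where w: "window I T0 j = {a..b}" "1 \<le> a" "a \<le> b" "b \<le> horizon I"
    using window_cases assms(2) unfolding block_starts_def by blast
  have M: "Min (window I T0 j) = a" using w Min_atLeastAtMost by simp
  have "a + s - 1 \<in> window I T0 j" using assms(3) w by auto
  moreover from this have "a + s - 1 \<in> {1..horizon I}" using w by auto
  ultimately have "block_of T0 t (a + s - 1) = j"
    using mem_window_iff[OF assms(1)] assms(2) unfolding block_starts_def by blast
  then show ?thesis unfolding shift_sol_def glue_def using assms(3) by (simp add: M)
qed

lemma
  assumes "T0 \<ge> 1" "j \<in> block_starts I T0 t"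
  shows mk_value_glue:
      "mk_value (block I T0 j) (shift_sol (window I T0 j) (glue I T0 t F)) = mk_value (block I T0 j) (F j)"
    and feasible_glue:
      "feasible (block I T0 j) (shift_sol (window I T0 j) (glue I T0 t F)) \<longleftrightarrow> feasible (block I T0 j) (F j)"
    and outputs_glue:
      "outputs P (block I T0 j) (shift_sol (window I T0 j) (glue I T0 t F)) \<tau>
        \<longleftrightarrow> outputs P (block I T0 j) (F j) \<tau>"
  using mk_value_cong feasible_cong outputs_cong shift_sol_glue[OF assms] horizon_subinstance by metis+

lemma feasible_iff_blocks:
  assumes "T0 \<ge> 1"
  shows "feasible I S \<longleftrightarrow> (\<forall>j\<in>block_starts I T0 t. feasible (block I T0 j) (shift_sol (window I T0 j) S))"
proof -
  have "feasible (block I T0 j) (shift_sol (window I T0 j) S)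
      \<longleftrightarrow> (\<forall>t\<in>window I T0 j. S t \<subseteq> objects I \<and> (\<Sum>i\<in>S t. weight I t i) \<le> capacity I t)"
    if "j \<in> block_starts I T0 t" for j
    using that feasible_subinstance unfolding block_starts_def by (smt (verit) mem_Collect_eq window_cases)
  moreover have "{1..horizon I} = (\<Union>j\<in>block_starts I T0 t. window I T0 j)"
  proof (rule set_eqI)
    fix s
    have "s \<in> {1..horizon I}" if "s \<in> window I T0 j" for j using that unfolding window_def by simp
    then show "s \<in> {1..horizon I} \<longleftrightarrow> s \<in> (\<Union>j\<in>block_starts I T0 t. window I T0 j)"
      unfolding block_starts_eq[OF assms] using block_of_mem[OF assms, of s I t] by blast
  qed
  moreover have "feasible I S \<longleftrightarrow> (\<forall>t\<in>{1..horizon I}. S t \<subseteq> objects I \<and> (\<Sum>i\<in>S t. weight I t i) \<le> capacity I t)"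
    unfolding feasible_def selection_def by blast
  ultimately show ?thesis by simp
qed

text \<open>Every profit belongs to one block, and the bonus between \<open>s\<close> and
  \<open>s + 1\<close> survives the restriction iff both steps share a block. The identity is used
  in both directions: with cut bonuses bounded below by 0 for concatenations, and with their exact
  amount for an optimal solution.\<close>

lemma mk_value_blocks:
  assumes "T0 \<ge> 1"
  shows "mk_value I S = (\<Sum>j\<in>block_starts I T0 t. mk_value (block I T0 j) (shift_sol (window I T0 j) S))
    + (\<Sum>s\<in>{s\<in>{1..<horizon I}. (int s + 1) mod int T0 = int t mod int T0}. step_bonus I S s)"
proof -
  let ?B = "block_of T0 t" and ?W = "block_starts I T0 t"
  let ?cut = "{s\<in>{1..<horizon I}. (int s + 1) mod int T0 = int t mod int T0}"
  let ?in = "{s\<in>{1..<horizon I}. ?B (s + 1) = ?B s}"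
  have fin: "finite ?W" unfolding block_starts_eq[OF assms] by simp
  have in_block: "s \<in> window I T0 j \<longleftrightarrow> s \<in> {1..horizon I} \<and> ?B s = j" if "j \<in> ?W" for j s
    using that mem_window_iff[OF assms, of j t s I] unfolding block_starts_def window_def by auto
  have val: "mk_value (block I T0 j) (shift_sol (window I T0 j) S)
      = (\<Sum>s\<in>{s\<in>{1..horizon I}. ?B s = j}. step_profit I S s) + (\<Sum>s\<in>{s\<in>?in. ?B s = j}. step_bonus I S s)"
    if j: "j \<in> ?W" for j
  proof -
    obtain a b where w: "window I T0 j = {a..b}" "1 \<le> a" "a \<le> b" "b \<le> horizon I"
      using window_cases j unfolding block_starts_def by blast
    have m: "s \<in> {1..horizon I} \<and> ?B s = j \<longleftrightarrow> s \<in> {a..b}" for s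
      using in_block[OF j] w(1) by simp
    have 1: "{s\<in>{1..horizon I}. ?B s = j} = {a..b}" using m by blast
    have "s \<in> ?in \<and> ?B s = j \<longleftrightarrow> s \<in> {a..<b}" for s
    proof -
      have "s \<in> ?in \<and> ?B s = j \<longleftrightarrow> s \<in> {1..horizon I} \<and> ?B s = j \<and> s + 1 \<in> {1..horizon I} \<and> ?B (s + 1) = j"
        by auto
      then show ?thesis unfolding conj_assoc[symmetric] m using m[of s] m[of "s + 1"] by fastforce
    qed
    then have 2: "{s\<in>?in. ?B s = j} = {a..<b}" by blast
    show ?thesis unfolding 1 2 using mk_value_subinstance[OF w(1-3)] by simp
  qed
  have "(\<Sum>j\<in>?W. mk_value (block I T0 j) (shift_sol (window I T0 j) S))
      = (\<Sum>j\<in>?W. \<Sum>s\<in>{s\<in>{1..horizon I}. ?B s = j}. step_profit I S s)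
        + (\<Sum>j\<in>?W. \<Sum>s\<in>{s\<in>?in. ?B s = j}. step_bonus I S s)"
    using val by (simp add: sum.distrib)
  also have "\<dots> = sum (step_profit I S) {1..horizon I} + sum (step_bonus I S) ?in"
    by (intro arg_cong2[where f = plus] sum.group) (auto simp: fin block_starts_eq[OF assms])
  finally have "(\<Sum>j\<in>?W. mk_value (block I T0 j) (shift_sol (window I T0 j) S))
      = sum (step_profit I S) {1..horizon I} + sum (step_bonus I S) ?in" .
  moreover have "sum (step_bonus I S) {1..<horizon I} = sum (step_bonus I S) ?in + sum (step_bonus I S) ?cut"
  proof -
    have split: "?in \<union> ?cut = {1..<horizon I}" "?in \<inter> ?cut = {}"
      using block_of_Suc_eq_iff[OF assms] by auto
    show ?thesis
      using sum.union_disjoint[of ?in ?cut "step_bonus I S"] unfolding split by simp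
  qed
  ultimately show ?thesis unfolding mk_value_eq by simp
qed

section \<open>The optimum and its bounds\<close>

lemma finite_values: "finite {mk_value I S | S. feasible I S}"
proof -
  have "mk_value I S \<in> mk_value I ` ({1..horizon I} \<rightarrow>\<^sub>E Pow (objects I))" if "feasible I S" for S
  proof
    show "mk_value I S = mk_value I (restrict S {1..horizon I})" by (rule mk_value_cong) simp
    show "restrict S {1..horizon I} \<in> {1..horizon I} \<rightarrow>\<^sub>E Pow (objects I)"
      using that unfolding feasible_def selection_def by auto
  qed
  then have "{mk_value I S | S. feasible I S} \<subseteq> mk_value I ` ({1..horizon I} \<rightarrow>\<^sub>E Pow (objects I))" by blast
  moreover have "finite ({1..horizon I} \<rightarrow>\<^sub>E Pow (objects I))"
    by (intro finite_PiE) (simp_all add: objects_def)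
  ultimately show ?thesis using finite_subset by blast
qed

lemma mk_opt_upper: "feasible I S \<Longrightarrow> mk_value I S \<le> mk_opt I"
  unfolding mk_opt_def using finite_values by (intro Max_ge) auto

lemma feasible_empty: "mk_instance I \<Longrightarrow> feasible I (\<lambda>_. {})"
  unfolding feasible_def selection_def mk_instance_def by auto

lemma mk_opt_attained:
  assumes "mk_instance I"
  obtains S where "feasible I S" "mk_value I S = mk_opt I"
proof -
  have "mk_opt I \<in> {mk_value I S | S. feasible I S}"
    unfolding mk_opt_def using feasible_empty[OF assms] finite_values by (intro Max_in) auto
  then show ?thesis using that by auto
qed

lemma step_bonus_nonneg:
  assumes "mk_instance I" "selection I S" "s \<in> {1..<horizon I}"
  shows "0 \<le> step_bonus I S s"
proof -
  have "S s \<subseteq> objects I" using assms(2,3) unfolding selection_def by auto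
  then show ?thesis
    using assms(1,3) unfolding step_bonus_def Delta_def mk_instance_def by (intro sum_nonneg) auto
qed

lemma bonus_le_mk_opt:
  assumes "mk_instance I" "selection I S"
  shows "sum (step_bonus I S) {1..<horizon I} \<le> mk_opt I"
proof -
  have "step_bonus I S s \<le> step_bonus I (\<lambda>_. {}) s" if s: "s \<in> {1..<horizon I}" for s
  proof -
    have "S s \<subseteq> objects I" using assms(2) s unfolding selection_def by auto
    then show ?thesis
      using assms(1) s unfolding step_bonus_def mk_instance_def
      by (intro sum_mono2) (auto simp: Delta_def objects_def)
  qed
  then have "sum (step_bonus I S) {1..<horizon I} \<le> mk_value I (\<lambda>_. {})"
    using sum_mono[of "{1..<horizon I}" "step_bonus I S" "step_bonus I (\<lambda>_. {})"]
    unfolding mk_value_eq by (simp add: step_profit_def)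
  also have "\<dots> \<le> mk_opt I" using mk_opt_upper feasible_empty assms(1) by blast
  finally show ?thesis .
qed

text \<open>Profits may be negative, but the optimum dominates a sum of bonuses. The sign is needed
  when the approximation factors are compared.\<close>

lemma mk_opt_nonneg:
  assumes "mk_instance I" shows "0 \<le> mk_opt I"
proof -
  have "selection I (\<lambda>_. {})" using feasible_empty[OF assms] unfolding feasible_def by simp
  then show ?thesis
    using bonus_le_mk_opt[OF assms] step_bonus_nonneg[OF assms] sum_nonneg by (metis (no_types, lifting) order_trans)
qed

text \<open>The bonuses at the cuts, which no block sees, are nonnegative.\<close>

lemma block_values_le:
  assumes "mk_instance I" "T0 \<ge> 1" "selection I S"
  shows "(\<Sum>j\<in>block_starts I T0 t. mk_value (block I T0 j) (shift_sol (window I T0 j) S)) \<le> mk_value I S"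
proof -
  have "0 \<le> (\<Sum>s\<in>{s\<in>{1..<horizon I}. (int s + 1) mod int T0 = int t mod int T0}. step_bonus I S s)"
    by (rule sum_nonneg) (use step_bonus_nonneg[OF assms(1,3)] in blast)
  then show ?thesis unfolding mk_value_blocks[OF assms(2), of I S t] by linarith
qed

section \<open>Averaging over the offsets\<close>

definition block_opts :: "mk_inst \<Rightarrow> nat \<Rightarrow> nat \<Rightarrow> rat" where
  "block_opts I T0 t = (\<Sum>j\<in>block_starts I T0 t. mk_opt (block I T0 j))"

text \<open>Optimal solutions of the blocks glue to a feasible solution of the whole instance, and
  the concatenation only gains.\<close>

lemma block_opts_le:
  assumes "mk_instance I" "T0 \<ge> 1"
  shows "block_opts I T0 t \<le> mk_opt I"
proof -
  have "\<forall>j\<in>block_starts I T0 t. \<exists>S. feasible (block I T0 j) S \<and> mk_value (block I T0 j) S = mk_opt (block I T0 j)"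
    using mk_opt_attained mk_instance_block assms(1) unfolding block_starts_def by (metis (mono_tags, lifting) mem_Collect_eq)
  then obtain F where F: "\<And>j. j \<in> block_starts I T0 t \<Longrightarrow>
      feasible (block I T0 j) (F j) \<and> mk_value (block I T0 j) (F j) = mk_opt (block I T0 j)"
    by metis
  let ?G = "glue I T0 t F"
  have feas: "feasible I ?G"
    unfolding feasible_iff_blocks[OF assms(2), of I ?G t] using F feasible_glue[OF assms(2)] by blast
  have "block_opts I T0 t = (\<Sum>j\<in>block_starts I T0 t. mk_value (block I T0 j) (shift_sol (window I T0 j) ?G))"
    unfolding block_opts_def using F mk_value_glue[OF assms(2)] by (intro sum.cong) auto
  also have "\<dots> \<le> mk_value I ?G"
    using block_values_le[OF assms] feas unfolding feasible_def by blast
  also have "\<dots> \<le> mk_opt I" using mk_opt_upper feas by blast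
  finally show ?thesis .
qed

lemma sum_block_opts_ge:
  assumes "mk_instance I" "T0 \<ge> 1"
  shows "(of_nat T0 - 1) * mk_opt I \<le> (\<Sum>t\<in>{1..T0}. block_opts I T0 t)"
proof -
  obtain S where S: "feasible I S" "mk_value I S = mk_opt I"
    using mk_opt_attained assms(1) by blast
  have sel: "selection I S" using S(1) unfolding feasible_def by simp
  let ?cut = "\<lambda>t. {s\<in>{1..<horizon I}. (int s + 1) mod int T0 = int t mod int T0}"
  have *: "mk_opt I - sum (step_bonus I S) (?cut t) \<le> block_opts I T0 t" for t
  proof -
    have "(\<Sum>j\<in>block_starts I T0 t. mk_value (block I T0 j) (shift_sol (window I T0 j) S)) \<le> block_opts I T0 t"
      unfolding block_opts_def using S(1) feasible_iff_blocks[OF assms(2)] mk_opt_upper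
      by (intro sum_mono) blast
    then show ?thesis using mk_value_blocks[OF assms(2), of I S t] S(2) by simp
  qed
  \<comment> \<open>Offsets run through \<open>{1..T0}\<close> but residues start at 0, so the
    offset with a block starting at \<open>s\<close> is one plus the residue of
    \<open>s - 1\<close>. Applied to \<open>s + 1\<close>, it labels the cut between
    \<open>s\<close> and \<open>s + 1\<close> by one plus the residue of \<open>s\<close>, a
    function of \<open>s\<close>, as grouping the sum requires.\<close>
  have ex1: "s mod int T0 = int t mod int T0 \<longleftrightarrow> nat ((s - 1) mod int T0) + 1 = t" if "t \<in> {1..T0}" for s t
  proof -
    have "s mod int T0 = int t mod int T0 \<longleftrightarrow> (s - 1) mod int T0 = (int t - 1) mod int T0"
      by (simp add: mod_eq_dvd_iff)
    moreover have "(int t - 1) mod int T0 = int t - 1" using that by simp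
    moreover have "0 \<le> (s - 1) mod int T0" using assms(2) by simp
    ultimately show ?thesis using that by auto
  qed
  have "(\<Sum>t\<in>{1..T0}. sum (step_bonus I S) (?cut t))
      = (\<Sum>t\<in>{1..T0}. sum (step_bonus I S) {s\<in>{1..<horizon I}. nat (int s mod int T0) + 1 = t})"
    by (intro sum.cong arg_cong[where f = "sum (step_bonus I S)"]) (auto simp: ex1)
  also have "\<dots> = sum (step_bonus I S) {1..<horizon I}"
  proof (rule sum.group)
    have "nat (int s mod int T0) < T0" for s using assms(2) by (simp add: nat_less_iff)
    then show "(\<lambda>s. nat (int s mod int T0) + 1) ` {1..<horizon I} \<subseteq> {1..T0}"
      by (auto simp: Suc_le_eq)
  qed simp_all
  also have "\<dots> \<le> mk_opt I" using bonus_le_mk_opt assms(1) sel by blast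
  finally have cut: "(\<Sum>t\<in>{1..T0}. sum (step_bonus I S) (?cut t)) \<le> mk_opt I" .
  have "(of_nat T0 - 1) * mk_opt I \<le> (\<Sum>t\<in>{1..T0}. mk_opt I - sum (step_bonus I S) (?cut t))"
    using cut by (simp add: sum_subtractf algebra_simps)
  also have "\<dots> \<le> (\<Sum>t\<in>{1..T0}. block_opts I T0 t)" using * by (rule sum_mono)
  finally show ?thesis .
qed

section \<open>Execution of the program\<close>

definition eval_within :: "prog \<Rightarrow> (string \<rightharpoonup> val) \<Rightarrow> expr \<Rightarrow> val \<Rightarrow> nat \<Rightarrow> bool" where
  "eval_within P env e v B \<longleftrightarrow> (\<exists>\<tau>\<le>B. eval P env e v \<tau>)"

definition evals_within :: "prog \<Rightarrow> (string \<rightharpoonup> val) \<Rightarrow> expr list \<Rightarrow> val list \<Rightarrow> nat \<Rightarrow> bool" where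
  "evals_within P env es vs B \<longleftrightarrow> (\<exists>\<tau>\<le>B. evals P env es vs \<tau>)"

text \<open>Only the parameters are bound in the body, so a fact of this form holds at every call
  site, whatever the environment there. The overhead of the call and the cost of the arguments are
  charged by \<open>within_Call\<close>.\<close>

definition call_within :: "prog \<Rightarrow> string \<Rightarrow> val list \<Rightarrow> val \<Rightarrow> nat \<Rightarrow> bool" where
  "call_within P f vs v B \<longleftrightarrow> (\<exists>xs e. map_of P f = Some (xs, e) \<and> length xs = length vs
     \<and> eval_within P (map_of (zip xs vs)) e v B)"

lemma eval_within_weaken:
  "eval_within P env e v B \<Longrightarrow> v = v' \<Longrightarrow> B \<le> B' \<Longrightarrow> eval_within P env e v' B'"
  unfolding eval_within_def using order_trans by blast

lemma within_Var: "x \<in> dom env \<Longrightarrow> eval_within P env (Var x) (the (env x)) 1"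
  unfolding eval_within_def using eval_Var by fastforce

lemma within_Lit: "eval_within P env (Lit v) v 1"
  unfolding eval_within_def using eval_Lit by blast

lemma within_Op: "evals_within P env es vs B \<Longrightarrow> eval_within P env (Op oper es) (apply_op oper vs) (B + 1)"
  unfolding eval_within_def evals_within_def using eval_Op by fastforce

text \<open>The branch taken is left as an \<open>if\<close> in the goal, so that a body is evaluated by syntax-directed
  application of these rules, the simplifier deciding only the conditions.\<close>

lemma within_Cond:
  assumes "eval_within P env c u B1" and "eval_within P env (if u \<noteq> Num 0 then e1 else e2) v B2"
  shows "eval_within P env (Cond c e1 e2) v (B1 + B2 + 1)"
proof -
  obtain \<tau>1 \<tau>2 where \<tau>: "\<tau>1 \<le> B1" "\<tau>2 \<le> B2" "eval P env c u \<tau>1"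
    "eval P env (if u \<noteq> Num 0 then e1 else e2) v \<tau>2"
    using assms unfolding eval_within_def by blast
  then have "eval P env (Cond c e1 e2) v (\<tau>1 + \<tau>2 + 1)"
    by (cases "u = Num 0") (auto intro: eval_Cond_True[simplified] eval_Cond_False[simplified])
  with \<tau>(1,2) show ?thesis unfolding eval_within_def by (intro exI[of _ "\<tau>1 + \<tau>2 + 1"]) simp
qed

text \<open>Evaluation yields the arguments as unsimplified terms, such as
  \<open>of_nat (Suc k) - 1\<close>. The separate equation \<open>vs = vs'\<close> lets the
  simplifier match them with the arguments of an already known call.\<close>

lemma within_Call:
  assumes "evals_within P env es vs B1" and "vs = vs'" and "call_within P f vs' v B2"
  shows "eval_within P env (Call f es) v (B1 + B2 + 1)"
proof -
  obtain \<tau>1 where \<tau>1: "\<tau>1 \<le> B1" "evals P env es vs' \<tau>1"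
    using assms(1,2) unfolding evals_within_def by blast
  obtain xs e \<tau>2 where *: "map_of P f = Some (xs, e)" "length xs = length vs'" "\<tau>2 \<le> B2"
    "eval P (map_of (zip xs vs')) e v \<tau>2"
    using assms(3) unfolding call_within_def eval_within_def by blast
  show ?thesis
    unfolding eval_within_def using eval_Call[OF \<tau>1(2) *(1,2,4)] \<tau>1(1) *(3)
    by (intro exI[of _ "\<tau>1 + \<tau>2 + 1"]) simp
qed

lemma within_Use:
  assumes "evals_within P env es vs B1" and "vs = [u]" and "exec Q u v \<tau>" and "\<tau> \<le> B2"
  shows "eval_within P env (Use Q es) v (B1 + B2 + 1)"
proof -
  obtain \<tau>1 where \<tau>1: "\<tau>1 \<le> B1" "evals P env es [u] \<tau>1"
    using assms(1,2) unfolding evals_within_def by blast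
  obtain f x e R where *: "Q = (f, [x], e) # R" "eval Q [x \<mapsto> u] e v \<tau>"
    using assms(3) unfolding exec_def by blast
  have "eval P env (Use Q es) v (\<tau>1 + \<tau> + 1)"
    by (rule eval_Use[OF \<tau>1(2) *(1)]) (use *(2) in simp_all)
  with \<tau>1(1) assms(4) show ?thesis
    unfolding eval_within_def by (intro exI[of _ "\<tau>1 + \<tau> + 1"]) simp
qed

lemma within_Nil: "evals_within P env [] [] 0"
  unfolding evals_within_def using evals_Nil by blast

lemma within_Cons:
  "eval_within P env e v B1 \<Longrightarrow> evals_within P env es vs B2 \<Longrightarrow> evals_within P env (e # es) (v # vs) (B1 + B2)"
  unfolding eval_within_def evals_within_def using evals_Cons add_mono by blast

lemma within_if_True: "b \<Longrightarrow> eval_within P env e1 v B \<Longrightarrow> eval_within P env (if b then e1 else e2) v B"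
  by simp

lemma within_if_False: "\<not> b \<Longrightarrow> eval_within P env e2 v B \<Longrightarrow> eval_within P env (if b then e1 else e2) v B"
  by simp

lemmas within_intros = within_Lit within_Op within_Cond within_Nil within_Cons

lemma call_within_lookup:
  "map_of P f = Some (xs, e) \<Longrightarrow> eval_within P (map_of (zip xs vs)) e v B \<Longrightarrow> length xs = length vs
    \<Longrightarrow> call_within P f vs v B"
  unfolding call_within_def by blast

lemma call_within_weaken:
  "call_within P f vs v B \<Longrightarrow> v = v' \<Longrightarrow> B \<le> B' \<Longrightarrow> call_within P f vs v' B'"
  unfolding call_within_def using eval_within_weaken by blast

lemmas prog_defs = ptas_prog_def value_funs_def list_funs_def

section \<open>List functions of the program\<close>

text \<open>The pattern of all lemmas about the program: \<open>eval_within_weaken\<close> leaves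
  result and cost open, the syntax-directed rules compute both, and the simplifier compares them
  with the claim. The constants are generous roundings: 20 exceeds the cost of one recursive round,
  10 that of the last call.\<close>

lemma call_take:
  "call_within (ptas_prog Q T0) ''take'' [Num (of_nat k), list_val xs] (list_val (take k xs)) (20 * k + 10)"
proof (induction k arbitrary: xs)
  case 0
  show ?case
    by (rule call_within_lookup, simp add: prog_defs, rule eval_within_weaken,
      (rule within_intros | (rule within_Var, (simp; fail))
        | (rule within_if_True, (simp; fail)) | (rule within_if_False, (simp; fail))
        | (simp; fail))+)
next
  case (Suc k)
  show ?case
  proof (cases xs)
    case Nil
    show ?thesis
      by (rule call_within_lookup, simp add: prog_defs, rule eval_within_weaken,
      (rule within_intros | (rule within_Var, (simp; fail))
        | (rule within_if_True, (simp add: Nil; fail)) | (rule within_if_False, (simp add: Nil; fail))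
        | (simp add: Nil; fail))+)
  next
    case (Cons x xs')
    show ?thesis
      by (rule call_within_lookup, simp add: prog_defs, rule eval_within_weaken,
      (rule within_intros within_Call[OF _ _ Suc.IH[of xs']] | (rule within_Var, (simp; fail))
        | (rule within_if_True, (simp add: Cons; fail)) | (rule within_if_False, (simp add: Cons; fail))
        | (simp add: Cons; fail))+)
  qed
qed

lemma call_drop:
  "call_within (ptas_prog Q T0) ''drop'' [Num (of_nat k), list_val xs] (list_val (drop k xs)) (20 * k + 10)"
proof (induction k arbitrary: xs)
  case 0
  show ?case
    by (rule call_within_lookup, simp add: prog_defs, rule eval_within_weaken,
      (rule within_intros | (rule within_Var, (simp; fail))
        | (rule within_if_True, (simp; fail)) | (rule within_if_False, (simp; fail))
        | (simp; fail))+)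
next
  case (Suc k)
  show ?case
  proof (cases xs)
    case Nil
    show ?thesis
      by (rule call_within_lookup, simp add: prog_defs, rule eval_within_weaken,
      (rule within_intros | (rule within_Var, (simp; fail))
        | (rule within_if_True, (simp add: Nil; fail)) | (rule within_if_False, (simp add: Nil; fail))
        | (simp add: Nil; fail))+)
  next
    case (Cons x xs')
    show ?thesis
      by (rule call_within_lookup, simp add: prog_defs, rule eval_within_weaken,
      (rule within_intros within_Call[OF _ _ Suc.IH[of xs']] | (rule within_Var, (simp; fail))
        | (rule within_if_True, (simp add: Cons; fail)) | (rule within_if_False, (simp add: Cons; fail))
        | (simp add: Cons; fail))+)
  qed
qed

lemma call_append:
  "call_within (ptas_prog Q T0) ''append'' [list_val xs, list_val ys] (list_val (xs @ ys)) (20 * length xs + 10)"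
proof (induction xs)
  case Nil
  show ?case
    by (rule call_within_lookup, simp add: prog_defs, rule eval_within_weaken,
      (rule within_intros | (rule within_Var, (simp; fail))
        | (rule within_if_True, (simp; fail)) | (rule within_if_False, (simp; fail))
        | (simp; fail))+)
next
  case (Cons x xs)
  show ?case
    by (rule call_within_lookup, simp add: prog_defs, rule eval_within_weaken,
      (rule within_intros within_Call[OF _ _ Cons.IH] | (rule within_Var, (simp; fail))
        | (rule within_if_True, (simp; fail)) | (rule within_if_False, (simp; fail))
        | (simp; fail))+)
qed

section \<open>Computing the value of a solution\<close>

text \<open>The list of indices is arbitrary so that induction on it goes through; the 0-1 entries
  turn the products of the program into an \<open>if\<close>.\<close>

lemma call_profit:
  "call_within (ptas_prog Q T0) ''profit''
     [list_val (map (\<lambda>i. Num (p i)) js), list_val (map (\<lambda>i. Num (if i \<in> X then 1 else 0)) js)]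
     (Num (\<Sum>i\<leftarrow>js. if i \<in> X then p i else 0)) (20 * length js + 10)"
proof (induction js)
  case Nil
  show ?case
    by (rule call_within_lookup, simp add: prog_defs, rule eval_within_weaken,
      (rule within_intros | (rule within_Var, (simp; fail))
        | (rule within_if_True, (simp; fail)) | (rule within_if_False, (simp; fail))
        | (simp; fail))+)
next
  case (Cons i js)
  show ?case
    by (rule call_within_lookup, simp add: prog_defs, rule eval_within_weaken,
      (rule within_intros within_Call[OF _ _ Cons.IH] | (rule within_Var, (simp; fail))
        | (rule within_if_True, (simp; fail)) | (rule within_if_False, (simp; fail))
        | (simp; fail))+)
qed

lemma call_bonus:
  "call_within (ptas_prog Q T0) ''bonus''
     [list_val (map (\<lambda>i. Num (b i)) js), list_val (map (\<lambda>i. Num (if i \<in> X then 1 else 0)) js),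
      list_val (map (\<lambda>i. Num (if i \<in> Y then 1 else 0)) js)]
     (Num (\<Sum>i\<leftarrow>js. if i \<in> X \<longleftrightarrow> i \<in> Y then b i else 0)) (40 * length js + 10)"
proof (induction js)
  case Nil
  show ?case
    by (rule call_within_lookup, simp add: prog_defs, rule eval_within_weaken,
      (rule within_intros | (rule within_Var, (simp; fail))
        | (rule within_if_True, (simp; fail)) | (rule within_if_False, (simp; fail))
        | (simp; fail))+)
next
  case (Cons i js)
  \<comment> \<open>The nested conditionals of the body compare the two rows at \<open>i\<close>;
    fixing both memberships lets the simplifier decide every branch.\<close>
  consider (1) "i \<in> X" "i \<in> Y" | (2) "i \<in> X" "i \<notin> Y" | (3) "i \<notin> X" "i \<in> Y" | (4) "i \<notin> X" "i \<notin> Y"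
    by blast
  then show ?case
  proof cases
    case 1
    show ?thesis
      by (rule call_within_lookup, simp add: prog_defs, rule eval_within_weaken,
      (rule within_intros within_Call[OF _ _ Cons.IH] | (rule within_Var, (simp; fail))
        | (rule within_if_True, (simp add: 1; fail)) | (rule within_if_False, (simp add: 1; fail))
        | (simp add: 1; fail))+)
  next
    case 2
    show ?thesis
      by (rule call_within_lookup, simp add: prog_defs, rule eval_within_weaken,
      (rule within_intros within_Call[OF _ _ Cons.IH] | (rule within_Var, (simp; fail))
        | (rule within_if_True, (simp add: 2; fail)) | (rule within_if_False, (simp add: 2; fail))
        | (simp add: 2; fail))+)
  next
    case 3
    show ?thesis
      by (rule call_within_lookup, simp add: prog_defs, rule eval_within_weaken,
      (rule within_intros within_Call[OF _ _ Cons.IH] | (rule within_Var, (simp; fail))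
        | (rule within_if_True, (simp add: 3; fail)) | (rule within_if_False, (simp add: 3; fail))
        | (simp add: 3; fail))+)
  next
    case 4
    show ?thesis
      by (rule call_within_lookup, simp add: prog_defs, rule eval_within_weaken,
      (rule within_intros within_Call[OF _ _ Cons.IH] | (rule within_Var, (simp; fail))
        | (rule within_if_True, (simp add: 4; fail)) | (rule within_if_False, (simp add: 4; fail))
        | (simp add: 4; fail))+)
  qed
qed

lemma call_value_Nil: "call_within (ptas_prog Q T0) ''value'' [Null, bo, sol] (Num 0) 10"
  by (rule call_within_lookup, simp add: prog_defs, rule eval_within_weaken,
      (rule within_intros | (rule within_Var, (simp; fail))
        | (rule within_if_True, (simp; fail)) | (rule within_if_False, (simp; fail))
        | (simp; fail))+)

text \<open>The round for a final step: there is one bonus row fewer than steps, so the bonus list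
  is already exhausted. The rows are opaque here and only the results of the inner calls
  matter.\<close>

lemma call_value_single:
  assumes P: "call_within (ptas_prog Q T0) ''profit'' [p, x] (Num a) A"
    and V: "call_within (ptas_prog Q T0) ''value'' [st, Null, sol] (Num v) V"
  shows "call_within (ptas_prog Q T0) ''value'' [Cell (Cell c (Cell p w)) st, Null, Cell x sol]
    (Num (a + v)) (A + V + 40)"
  by (rule call_within_lookup, simp add: prog_defs, rule eval_within_weaken,
      (rule within_intros within_Call[OF _ _ P] within_Call[OF _ _ V] | (rule within_Var, (simp; fail))
        | (rule within_if_True, (simp; fail)) | (rule within_if_False, (simp; fail))
        | (simp; fail))+)

lemma call_value_Cell:
  assumes P: "call_within (ptas_prog Q T0) ''profit'' [p, x] (Num a) A"
    and B: "call_within (ptas_prog Q T0) ''bonus'' [b, x, y] (Num a') B"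
    and V: "call_within (ptas_prog Q T0) ''value'' [st, bo, Cell y sol] (Num v) V"
  shows "call_within (ptas_prog Q T0) ''value'' [Cell (Cell c (Cell p w)) st, Cell b bo, Cell x (Cell y sol)]
    (Num (a + (a' + v))) (A + B + V + 60)"
  by (rule call_within_lookup, simp add: prog_defs, rule eval_within_weaken,
      (rule within_intros within_Call[OF _ _ P] within_Call[OF _ _ B] within_Call[OF _ _ V] | (rule within_Var, (simp; fail))
        | (rule within_if_True, (simp; fail)) | (rule within_if_False, (simp; fail))
        | (simp; fail))+)

text \<open>Induction on the number of remaining steps, hence the suffixes from \<open>s\<close>.
  With n objects a step costs at most 20n + 10 for \<open>profit\<close>, 40n + 10 for
  \<open>bonus\<close> and 60 for the round itself, which gives the factor
  \<open>60 * nobj I + 100\<close>.\<close>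

lemma call_value:
  assumes "1 \<le> s"
  shows "call_within (ptas_prog Q T0) ''value''
     [list_val (map (step_val I) [s..<horizon I + 1]),
      list_val (map (\<lambda>t. row_val I (bonus I t)) [s..<horizon I]),
      list_val (map (\<lambda>t. row_val I (\<lambda>i. if i \<in> S t then 1 else 0)) [s..<horizon I + 1])]
     (Num ((\<Sum>t\<leftarrow>[s..<horizon I + 1]. \<Sum>i\<leftarrow>[1..<nobj I + 1]. if i \<in> S t then profit I t i else 0)
       + (\<Sum>t\<leftarrow>[s..<horizon I]. \<Sum>i\<leftarrow>[1..<nobj I + 1].
            if i \<in> S t \<longleftrightarrow> i \<in> S (t + 1) then bonus I t i else 0)))
     ((horizon I + 1 - s) * (60 * nobj I + 100) + 10)"
  using assms
proof (induction "horizon I + 1 - s" arbitrary: s)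
  case 0
  then have 1: "[s..<horizon I + 1] = []" "[s..<horizon I] = []" by simp_all
  show ?case
    unfolding 1 by (rule call_within_weaken, simp, rule call_value_Nil) simp_all
next
  case (Suc m)
  note IH = Suc.hyps(1)[of "s + 1"]
  have s: "s \<le> horizon I" using Suc.hyps(2) by simp
  have 1: "[s..<horizon I + 1] = s # [s + 1..<horizon I + 1]" using s by (simp add: upt_conv_Cons)
  have m: "horizon I + 1 - s = Suc (horizon I + 1 - (s + 1))" using s by simp
  note P = call_profit[where X = "S s" and p = "profit I s" and js = "[1..<nobj I + 1]", folded row_val_def, of Q T0]
  note B = call_bonus[where X = "S s" and Y = "S (s + 1)" and b = "bonus I s" and js = "[1..<nobj I + 1]", folded row_val_def, of Q T0]
  have IH': "call_within (ptas_prog Q T0) ''value''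
     [list_val (map (step_val I) [s + 1..<horizon I + 1]),
      list_val (map (\<lambda>t. row_val I (bonus I t)) [s + 1..<horizon I]),
      list_val (map (\<lambda>t. row_val I (\<lambda>i. if i \<in> S t then 1 else 0)) [s + 1..<horizon I + 1])]
     (Num ((\<Sum>t\<leftarrow>[s + 1..<horizon I + 1]. \<Sum>i\<leftarrow>[1..<nobj I + 1]. if i \<in> S t then profit I t i else 0)
       + (\<Sum>t\<leftarrow>[s + 1..<horizon I]. \<Sum>i\<leftarrow>[1..<nobj I + 1].
            if i \<in> S t \<longleftrightarrow> i \<in> S (t + 1) then bonus I t i else 0)))
     ((horizon I + 1 - (s + 1)) * (60 * nobj I + 100) + 10)"
    using IH Suc.hyps(2) by simp
  show ?case
  proof (cases "s = horizon I")
    case True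
    then have 2: "[s..<horizon I] = []" "[s + 1..<horizon I] = []" by simp_all
    show ?thesis
      unfolding 1 2 m list.map list_val.simps step_val_def
      by (rule call_within_weaken[OF call_value_single[OF P IH'[unfolded 2 list.map list_val.simps step_val_def]]])
        (simp_all del: upt_Suc)
  next
    case False
    then have 2: "[s..<horizon I] = s # [s + 1..<horizon I]"
      and 3: "[s + 1..<horizon I + 1] = (s + 1) # [s + 2..<horizon I + 1]"
      using s by (simp_all add: upt_conv_Cons)
    show ?thesis
      unfolding 1 2 3 m list.map list_val.simps step_val_def
      by (rule call_within_weaken[OF call_value_Cell[OF P B IH'[unfolded 3 list.map list_val.simps step_val_def]]])
        (simp_all del: upt_Suc)
  qed
qed

text \<open>The rows record membership of objects only. That \<open>S\<close> is a selection makes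
  the sums over objects marked in the rows equal to the sums over \<open>S t\<close> and
  \<open>Delta I S t\<close>.\<close>

lemma call_value_mk_value:
  assumes "selection I S"
  shows "call_within (ptas_prog Q T0) ''value''
     [list_val (map (step_val I) [1..<horizon I + 1]),
      list_val (map (\<lambda>t. row_val I (bonus I t)) [1..<horizon I]), sol_val I S]
     (Num (mk_value I S)) (horizon I * (60 * nobj I + 100) + 10)"
proof -
  have sel: "S t \<subseteq> objects I" if "t \<in> {1..horizon I}" for t
    using assms that unfolding selection_def by blast
  have row: "(\<Sum>i\<leftarrow>[1..<nobj I + 1]. if P i then g i else 0) = sum g {i\<in>objects I. P i}" for P and g :: "nat \<Rightarrow> rat"
    using sum.inter_filter[of "objects I" g P]
    by (simp add: sum_list_distinct_conv_sum_set objects_def atLeastLessThanSuc_atLeastAtMost del: upt_Suc)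
  have "{i\<in>objects I. i \<in> S t} = S t" if "t \<in> {1..horizon I}" for t
    using sel[OF that] by blast
  then have p: "(\<Sum>t\<leftarrow>[1..<horizon I + 1]. \<Sum>i\<leftarrow>[1..<nobj I + 1]. if i \<in> S t then profit I t i else 0)
      = sum (step_profit I S) {1..horizon I}"
    unfolding row step_profit_def
    by (simp add: sum_list_distinct_conv_sum_set atLeastLessThanSuc_atLeastAtMost del: upt_Suc)
  have "{i\<in>objects I. i \<in> S t \<longleftrightarrow> i \<in> S (t + 1)} = Delta I S t" if "t \<in> {1..<horizon I}" for t
    using sel[of t] sel[of "t + 1"] that unfolding Delta_def by auto
  then have b: "(\<Sum>t\<leftarrow>[1..<horizon I]. \<Sum>i\<leftarrow>[1..<nobj I + 1].
        if i \<in> S t \<longleftrightarrow> i \<in> S (t + 1) then bonus I t i else 0) = sum (step_bonus I S) {1..<horizon I}"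
    unfolding row step_bonus_def by (simp add: sum_list_distinct_conv_sum_set)
  show ?thesis
    using call_value[of 1 Q T0 I S] unfolding p b mk_value_eq sol_val_def by simp
qed

section \<open>Running the subroutine block by block\<close>

lemma call_blocks_Nil: "call_within (ptas_prog Q T0) ''blocks'' [k, Null, bo] Null 10"
  by (rule call_within_lookup, simp add: prog_defs, rule eval_within_weaken,
      (rule within_intros | (rule within_Var, (simp; fail))
        | (rule within_if_True, (simp; fail)) | (rule within_if_False, (simp; fail))
        | (simp; fail))+)

lemma call_blocks_Cell:
  assumes take_st: "call_within (ptas_prog Q T0) ''take'' [Num k, Cell x st] st1 A1"
    and take_bo: "call_within (ptas_prog Q T0) ''take'' [Num (k - 1), bo] bo1 A2"
    and Q: "exec Q (Cell st1 bo1) sol \<tau>" and \<tau>: "\<tau> \<le> D"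
    and drop_st: "call_within (ptas_prog Q T0) ''drop'' [Num k, Cell x st] st2 A3"
    and drop_bo: "call_within (ptas_prog Q T0) ''drop'' [Num k, bo] bo2 A4"
    and rest: "call_within (ptas_prog Q T0) ''blocks'' [Num (of_nat T0), st2, bo2] sols A5"
    and append: "call_within (ptas_prog Q T0) ''append'' [sol, sols] v A6"
  shows "call_within (ptas_prog Q T0) ''blocks'' [Num k, Cell x st, bo] v
    (A1 + A2 + D + A3 + A4 + A5 + A6 + 40)"
  by (rule call_within_lookup, simp add: prog_defs, rule eval_within_weaken,
      (rule within_intros within_Call[OF _ _ take_st] within_Call[OF _ _ take_bo] within_Use[OF _ _ Q \<tau>] within_Call[OF _ _ drop_st] within_Call[OF _ _ drop_bo] within_Call[OF _ _ rest] within_Call[OF _ _ append] | (rule within_Var, (simp; fail))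
        | (rule within_if_True, (simp; fail)) | (rule within_if_False, (simp; fail))
        | (simp; fail))+)

text \<open>The block of \<open>k\<close> steps from \<open>s\<close> ends where the next one
  starts, so the congruence is imposed on \<open>s + k\<close>. The condition
  \<open>s = 1 \<or> k = T0\<close> says that only the block at the beginning may be shorter for a
  reason other than the horizon. The induction is on the number of remaining steps.\<close>

lemma call_blocks:
  assumes "T0 \<ge> 1"
    and Q: "\<And>j. j \<in> block_starts I T0 t \<Longrightarrow>
      \<exists>\<tau>\<le>D. outputs Q (block I T0 j) (shift_sol (window I T0 j) S) \<tau>"
    and "1 \<le> k" "k \<le> T0" "1 \<le> s" "s = 1 \<or> k = T0" "(int s + int k) mod int T0 = int t mod int T0"
  shows "call_within (ptas_prog Q T0) ''blocks''
     [Num (of_nat k), list_val (map (step_val I) [s..<horizon I + 1]),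
      list_val (map (\<lambda>t. row_val I (bonus I t)) [s..<horizon I])]
     (list_val (map (\<lambda>t. row_val I (\<lambda>i. if i \<in> S t then 1 else 0)) [s..<horizon I + 1]))
     ((horizon I + 1 - s) * (D + 100 * T0 + 100) + 10)"
  using assms(3-)
proof (induction "horizon I + 1 - s" arbitrary: s k rule: less_induct)
  case less
  let ?T = "horizon I"
  let ?row = "\<lambda>t. row_val I (\<lambda>i. if i \<in> S t then 1 else 0)"
  let ?bonus = "\<lambda>t. row_val I (bonus I t)"
  show ?case
  proof (cases "s \<le> ?T")
    case False
    then have "[s..<?T + 1] = []" by simp
    then show ?thesis by (simp add: call_within_weaken[OF call_blocks_Nil] del: upt_Suc)
  next
    case True
    define b where "b = min ?T (s + k - 1)"
    have b: "s \<le> b" "b \<le> ?T" "b < s + k" using True less.prems unfolding b_def by auto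
    \<comment> \<open>The start under which \<open>concat_sol\<close> knows this block:
      \<open>s\<close> itself if \<open>k = T0\<close>, and a nonpositive number if
      \<open>s = 1\<close> and \<open>k < T0\<close>, where the window is truncated at step
      1.\<close>
    let ?j = "int s + int k - int T0"
    have w: "window I T0 ?j = {s..b}"
      using less.prems(2,3,4) unfolding window_def b_def by auto
    have "?j mod int T0 = int t mod int T0" using less.prems(5) by simp
    then have "?j \<in> block_starts I T0 t" using w b(1) unfolding block_starts_def by simp
    from Q[OF this] obtain \<tau> where \<tau>: "\<tau> \<le> D" "exec Q (inst_val (block I T0 ?j))
        (sol_val (block I T0 ?j) (shift_sol (window I T0 ?j) S)) \<tau>"
      unfolding outputs_def by blast
    note interval = w less.prems(3) b(1)
    \<comment> \<open>The block keeps only the bonuses between its own steps, at most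
      \<open>k - 1\<close> of them; \<open>drop\<close> later removes \<open>k\<close> rows, thereby
      discarding also the bonus at the cut.\<close>
    have take_st: "take k [s..<?T + 1] = [s..<b + 1]" and take_bo: "take (k - 1) [s..<?T] = [s..<b]"
      using less.prems(1) b unfolding b_def by (auto simp: take_upt min_def simp del: upt_Suc)
    have Q': "exec Q (Cell (list_val (map (step_val I) [s..<b + 1])) (list_val (map ?bonus [s..<b])))
        (list_val (map ?row [s..<b + 1])) \<tau>"
      using \<tau>(2) unfolding inst_val_subinstance[OF interval] sol_val_subinstance[OF interval] .
    have rest: "call_within (ptas_prog Q T0) ''blocks''
       [Num (of_nat T0), list_val (map (step_val I) [s + k..<?T + 1]), list_val (map ?bonus [s + k..<?T])]
       (list_val (map ?row [s + k..<?T + 1])) ((?T + 1 - (s + k)) * (D + 100 * T0 + 100) + 10)"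
      by (rule less.hyps) (use True less.prems assms(1) in auto)
    have split: "[s..<?T + 1] = [s..<b + 1] @ [s + k..<?T + 1]"
    proof (cases "s + k \<le> ?T")
      case True
      then have "b + 1 = s + k" unfolding b_def using less.prems(1) by auto
      then show ?thesis using True upt_add_eq_append[of s "s + k" "?T + 1 - (s + k)"] by simp
    next
      case False
      then have "b = ?T" "[s + k..<?T + 1] = []" unfolding b_def by auto
      then show ?thesis by simp
    qed
    have append: "call_within (ptas_prog Q T0) ''append''
       [list_val (map ?row [s..<b + 1]), list_val (map ?row [s + k..<?T + 1])]
       (list_val (map ?row [s..<?T + 1])) (20 * (b + 1 - s) + 10)"
      using call_append[of Q T0 "map ?row [s..<b + 1]" "map ?row [s + k..<?T + 1]"]
      unfolding split by (simp del: upt_Suc)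
    have cons: "list_val (map (step_val I) [s..<?T + 1])
        = Cell (step_val I s) (list_val (map (step_val I) [s + 1..<?T + 1]))"
      using True by (simp add: upt_conv_Cons del: upt_Suc)
    have A1: "call_within (ptas_prog Q T0) ''take''
        [Num (of_nat k), Cell (step_val I s) (list_val (map (step_val I) [s + 1..<?T + 1]))]
        (list_val (map (step_val I) [s..<b + 1])) (20 * k + 10)"
      using call_take[of Q T0 k "map (step_val I) [s..<?T + 1]"] unfolding cons take_map take_st .
    have A2: "call_within (ptas_prog Q T0) ''take'' [Num (of_nat k - 1), list_val (map ?bonus [s..<?T])]
        (list_val (map ?bonus [s..<b])) (20 * (k - 1) + 10)"
      using call_take[of Q T0 "k - 1" "map ?bonus [s..<?T]"] less.prems(1)
      unfolding take_map take_bo by (simp add: of_nat_diff)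
    have A3: "call_within (ptas_prog Q T0) ''drop''
        [Num (of_nat k), Cell (step_val I s) (list_val (map (step_val I) [s + 1..<?T + 1]))]
        (list_val (map (step_val I) [s + k..<?T + 1])) (20 * k + 10)"
      using call_drop[of Q T0 k "map (step_val I) [s..<?T + 1]"] unfolding cons drop_map drop_upt .
    have A4: "call_within (ptas_prog Q T0) ''drop'' [Num (of_nat k), list_val (map ?bonus [s..<?T])]
        (list_val (map ?bonus [s + k..<?T])) (20 * k + 10)"
      using call_drop[of Q T0 k "map ?bonus [s..<?T]"] unfolding drop_map drop_upt .
    \<comment> \<open>Five calls of list functions cost at most \<open>20 * T0 + 10\<close> each and
      the round itself 40, which stays below \<open>100 * T0 + 100\<close>.\<close>
    have "20 * k + 10 + (20 * (k - 1) + 10) + D + (20 * k + 10) + (20 * k + 10)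
        + ((?T + 1 - (s + k)) * (D + 100 * T0 + 100) + 10) + (20 * (b + 1 - s) + 10) + 40
        \<le> (?T + 1 - (s + k) + 1) * (D + 100 * T0 + 100) + 10"
      using less.prems(2) b by simp
    \<comment> \<open>As \<open>k \<ge> 1\<close>, a round consumes at least one remaining step and
      is charged to it.\<close>
    also have "\<dots> \<le> (?T + 1 - s) * (D + 100 * T0 + 100) + 10"
      using True less.prems(1) by (intro add_right_mono mult_right_mono) auto
    finally show ?thesis
      using call_within_weaken[OF call_blocks_Cell[OF A1 A2 Q' \<tau>(1) A3 A4 rest append] refl]
      unfolding cons by blast
  qed
qed

lemma call_candidate_1:
  assumes "call_within (ptas_prog Q T0) ''blocks'' [Num (of_nat T0), st, bo] v B"
  shows "call_within (ptas_prog Q T0) ''candidate'' [Num 1, st, bo] v (B + 20)"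
  by (rule call_within_lookup, simp add: prog_defs, rule eval_within_weaken,
      (rule within_intros within_Call[OF _ _ assms] | (rule within_Var, (simp; fail))
        | (rule within_if_True, (simp; fail)) | (rule within_if_False, (simp; fail))
        | (simp; fail))+)

lemma call_candidate_gt_1:
  assumes "1 < k" and blocks: "call_within (ptas_prog Q T0) ''blocks'' [Num (k - 1), st, bo] v B"
  shows "call_within (ptas_prog Q T0) ''candidate'' [Num k, st, bo] v (B + 20)"
proof -
  have k: "\<not> k \<le> 1" using assms(1) by simp
  show ?thesis
    by (rule call_within_lookup, simp add: prog_defs, rule eval_within_weaken,
      (rule within_intros within_Call[OF _ _ blocks] | (rule within_Var, (simp; fail))
        | (rule within_if_True, (simp add: k; fail)) | (rule within_if_False, (simp add: k; fail))
        | (simp add: k; fail))+)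
qed

text \<open>The first block has \<open>T0\<close> steps for \<open>t = 1\<close> and
  \<open>t - 1\<close> steps otherwise; in both cases the next block starts at a step congruent to
  \<open>t\<close>.\<close>

lemma call_candidate:
  assumes "t \<in> {1..T0}"
    and "\<And>j. j \<in> block_starts I T0 t \<Longrightarrow>
      \<exists>\<tau>\<le>D. outputs Q (block I T0 j) (shift_sol (window I T0 j) S) \<tau>"
  shows "call_within (ptas_prog Q T0) ''candidate''
     [Num (of_nat t), list_val (map (step_val I) [1..<horizon I + 1]),
      list_val (map (\<lambda>t. row_val I (bonus I t)) [1..<horizon I])]
     (sol_val I S) (horizon I * (D + 100 * T0 + 100) + 30)"
proof -
  have blocks: "call_within (ptas_prog Q T0) ''blocks''
     [Num (of_nat k), list_val (map (step_val I) [1..<horizon I + 1]),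
      list_val (map (\<lambda>t. row_val I (bonus I t)) [1..<horizon I])]
     (sol_val I S) (horizon I * (D + 100 * T0 + 100) + 10)"
    if "k \<in> {1..T0}" "(1 + int k) mod int T0 = int t mod int T0" for k
    using call_blocks[of T0 I t D Q S k 1, OF _ assms(2)] that unfolding sol_val_def by (simp del: upt_Suc)
  show ?thesis
  proof (cases "t = 1")
    case True
    have "T0 \<in> {1..T0}" "(1 + int T0) mod int T0 = int t mod int T0" using assms(1) True by simp_all
    from call_candidate_1[OF blocks[OF this]] show ?thesis
      unfolding True of_nat_1 by (rule call_within_weaken) simp_all
  next
    case False
    then have k: "t - 1 \<in> {1..T0}" "(1 + int (t - 1)) mod int T0 = int t mod int T0"
      and "1 < rat_of_nat t" and pred: "rat_of_nat (t - 1) = rat_of_nat t - 1"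
      using assms(1) by (auto simp: of_nat_diff)
    from call_candidate_gt_1[OF this(3) blocks[OF k, unfolded pred]] show ?thesis
      by (rule call_within_weaken) simp_all
  qed
qed

section \<open>Selecting the best candidate\<close>

lemma call_better:
  assumes V: "call_within (ptas_prog Q T0) ''value'' [st, bo, sol] (Num v) B"
    and V2: "call_within (ptas_prog Q T0) ''value'' [st, bo, sol2] (Num v2) B"
  shows "call_within (ptas_prog Q T0) ''better'' [st, bo, sol, sol2] (if v2 \<le> v then sol else sol2) (2 * B + 30)"
proof (cases "v2 \<le> v")
  case True
  show ?thesis
    by (rule call_within_lookup, simp add: prog_defs, rule eval_within_weaken,
      (rule within_intros within_Call[OF _ _ V] within_Call[OF _ _ V2] | (rule within_Var, (simp; fail))
        | (rule within_if_True, (simp add: True; fail)) | (rule within_if_False, (simp add: True; fail))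
        | (simp add: True; fail))+)
next
  case False
  show ?thesis
    by (rule call_within_lookup, simp add: prog_defs, rule eval_within_weaken,
      (rule within_intros within_Call[OF _ _ V] within_Call[OF _ _ V2] | (rule within_Var, (simp; fail))
        | (rule within_if_True, (simp add: False; fail)) | (rule within_if_False, (simp add: False; fail))
        | (simp add: False; fail))+)
qed

lemma call_best_1:
  assumes "call_within (ptas_prog Q T0) ''candidate'' [Num 1, st, bo] v B"
  shows "call_within (ptas_prog Q T0) ''best'' [Num 1, st, bo] v (B + 20)"
  by (rule call_within_lookup, simp add: prog_defs, rule eval_within_weaken,
      (rule within_intros within_Call[OF _ _ assms] | (rule within_Var, (simp; fail))
        | (rule within_if_True, (simp; fail)) | (rule within_if_False, (simp; fail))
        | (simp; fail))+)

lemma call_best_gt_1: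
  assumes "1 < k" and sol: "call_within (ptas_prog Q T0) ''candidate'' [Num k, st, bo] sol B1"
    and sol2: "call_within (ptas_prog Q T0) ''best'' [Num (k - 1), st, bo] sol2 B2"
    and better: "call_within (ptas_prog Q T0) ''better'' [st, bo, sol, sol2] v B3"
  shows "call_within (ptas_prog Q T0) ''best'' [Num k, st, bo] v (B1 + B2 + B3 + 40)"
proof -
  have k: "\<not> k \<le> 1" using assms(1) by simp
  show ?thesis
    by (rule call_within_lookup, simp add: prog_defs, rule eval_within_weaken,
      (rule within_intros within_Call[OF _ _ sol] within_Call[OF _ _ sol2] within_Call[OF _ _ better] | (rule within_Var, (simp; fail))
        | (rule within_if_True, (simp add: k; fail)) | (rule within_if_False, (simp add: k; fail))
        | (simp add: k; fail))+)
qed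

text \<open>Per offset there is one candidate, two value computations inside \<open>better\<close>,
  and an overhead of 30 there and 40 in \<open>best\<close>, which explains the summand 70.\<close>

lemma call_best:
  assumes sel: "\<And>t. t \<in> {1..m} \<Longrightarrow> selection I (Ss t)"
    and cand: "\<And>t. t \<in> {1..m} \<Longrightarrow> call_within (ptas_prog Q T0) ''candidate'' [Num (of_nat t), st, bo] (sol_val I (Ss t)) C"
    and st: "st = list_val (map (step_val I) [1..<horizon I + 1])"
    and bo: "bo = list_val (map (\<lambda>t. row_val I (bonus I t)) [1..<horizon I])"
    and "1 \<le> m"
  shows "\<exists>t\<in>{1..m}. (\<forall>t'\<in>{1..m}. mk_value I (Ss t') \<le> mk_value I (Ss t))
    \<and> call_within (ptas_prog Q T0) ''best'' [Num (of_nat m), st, bo] (sol_val I (Ss t))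
        (m * (C + 2 * (horizon I * (60 * nobj I + 100) + 10) + 70))"
  using assms(5) sel cand
proof (induction m rule: dec_induct)
  case base
  have "call_within (ptas_prog Q T0) ''candidate'' [Num 1, st, bo] (sol_val I (Ss 1)) C"
    using base(2)[of 1] by simp
  from call_within_weaken[OF call_best_1[OF this]] show ?case by simp
next
  case (step m)
  let ?V = "horizon I * (60 * nobj I + 100) + 10"
  obtain t where t: "t \<in> {1..m}" "\<forall>t'\<in>{1..m}. mk_value I (Ss t') \<le> mk_value I (Ss t)"
    "call_within (ptas_prog Q T0) ''best'' [Num (of_nat m), st, bo] (sol_val I (Ss t)) (m * (C + 2 * ?V + 70))"
    using step.IH[OF step.prems] by auto
  \<comment> \<open>Ties go to the candidate of larger offset, as in the comparison made by
    \<open>better\<close>.\<close>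
  let ?t = "if mk_value I (Ss t) \<le> mk_value I (Ss (Suc m)) then Suc m else t"
  have val: "call_within (ptas_prog Q T0) ''value'' [st, bo, sol_val I (Ss t')] (Num (mk_value I (Ss t'))) ?V"
    if "t' \<in> {1..Suc m}" for t'
    unfolding st bo by (rule call_value_mk_value) (use step.prems(1) that in blast)
  have better: "call_within (ptas_prog Q T0) ''better'' [st, bo, sol_val I (Ss (Suc m)), sol_val I (Ss t)]
      (sol_val I (Ss ?t)) (2 * ?V + 30)"
    using call_better[OF val[of "Suc m"] val[of t]] t(1) by (simp add: if_distrib)
  have best: "call_within (ptas_prog Q T0) ''best'' [Num (of_nat (Suc m) - 1), st, bo] (sol_val I (Ss t)) (m * (C + 2 * ?V + 70))"
    using t(3) by simp
  have "call_within (ptas_prog Q T0) ''best'' [Num (of_nat (Suc m)), st, bo] (sol_val I (Ss ?t))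
      (Suc m * (C + 2 * ?V + 70))"
    by (rule call_within_weaken[OF call_best_gt_1[OF _ step.prems(2) best better]]) (use step.hyps in auto)
  moreover have "?t \<in> {1..Suc m}" using t(1) by simp
  moreover have "\<forall>t'\<in>{1..Suc m}. mk_value I (Ss t') \<le> mk_value I (Ss ?t)"
    using t(2) by (auto simp: le_Suc_eq intro: order_trans)
  ultimately show ?case by blast
qed

lemma exec_main:
  assumes best: "call_within (ptas_prog Q T0) ''best'' [Num (of_nat T0), st, bo] v B"
  shows "\<exists>\<tau>\<le>B + 20. exec (ptas_prog Q T0) (Cell st bo) v \<tau>"
proof -
  have "call_within (ptas_prog Q T0) ''main'' [Cell st bo] v (B + 20)"
    by (rule call_within_lookup, simp add: prog_defs, rule eval_within_weaken,
      (rule within_intros within_Call[OF _ _ best] | (rule within_Var, (simp; fail))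
        | (rule within_if_True, (simp; fail)) | (rule within_if_False, (simp; fail))
        | (simp; fail))+)
  then show ?thesis
    unfolding call_within_def eval_within_def exec_def by (auto simp: ptas_prog_def)
qed

section \<open>Approximation ratio and running time\<close>

lemma length_le_val_size: "length vs \<le> val_size (list_val vs)"
  by (induction vs) simp_all

lemma horizon_le_size: "horizon I \<le> val_size (inst_val I)"
  using length_le_val_size[of "map (step_val I) [1..<horizon I + 1]"]
  unfolding inst_val_def by (simp del: upt_Suc)

text \<open>The profit row of the first step has one cell per object, which is why a first step has
  to exist.\<close>

lemma nobj_le_size:
  assumes "1 \<le> horizon I"
  shows "nobj I \<le> val_size (inst_val I)"
proof -
  have "nobj I \<le> val_size (row_val I (profit I 1))"
    using length_le_val_size[of "map (\<lambda>i. Num (profit I 1 i)) [1..<nobj I + 1]"]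
    unfolding row_val_def by (simp del: upt_Suc)
  then show ?thesis
    using assms unfolding inst_val_def by (simp add: upt_conv_Cons step_val_def del: upt_Suc)
qed

text \<open>For \<open>\<delta> > 1\<close> the guarantee for the blocks is a negative multiple of their optima, and
  the upper bound \<open>block_opts I T0 1 \<le> mk_opt I\<close> is the relevant one.\<close>

lemma approximation_ratio:
  assumes "mk_instance I" "0 < \<delta>" "1 / \<delta> \<le> real T0" "T0 \<ge> 1"
    and M: "\<And>t. t \<in> {1..T0} \<Longrightarrow> (1 - \<delta>) * real_of_rat (block_opts I T0 t) \<le> M"
  shows "(1 - 2 * \<delta>) * real_of_rat (mk_opt I) \<le> M"
proof -
  let ?opt = "real_of_rat (mk_opt I)"
  have opt: "0 \<le> ?opt" using mk_opt_nonneg[OF assms(1)] by simp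
  show ?thesis
  proof (cases "\<delta> \<le> 1")
    case True
    have "(real T0 - 1) * ?opt = real_of_rat ((of_nat T0 - 1) * mk_opt I)"
      by (simp add: of_rat_mult of_rat_diff)
    also have "\<dots> \<le> real_of_rat (\<Sum>t\<in>{1..T0}. block_opts I T0 t)"
      using sum_block_opts_ge[OF assms(1,4)] by (simp only: of_rat_less_eq)
    finally have "(1 - \<delta>) * ((real T0 - 1) * ?opt) \<le> (1 - \<delta>) * (\<Sum>t\<in>{1..T0}. real_of_rat (block_opts I T0 t))"
      using True by (intro mult_left_mono) (simp_all add: of_rat_sum)
    also have "\<dots> \<le> (\<Sum>t\<in>{1..T0}. M)"
      unfolding sum_distrib_left using M by (rule sum_mono)
    finally have 1: "(1 - \<delta>) * ((real T0 - 1) * ?opt) \<le> real T0 * M" by simp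
    \<comment> \<open>The factor \<open>T0 - 1\<close> is at least
      \<open>(1 - \<delta>) * T0\<close>, and (1 - \<delta>)^2 \<ge> 1 - 2\<delta>; the discarded
      square is the nonnegative term supplied below.\<close>
    have "1 \<le> \<delta> * real T0" using assms(2,3) by (simp add: field_simps)
    then have "(1 - \<delta>) * 1 \<le> (1 - \<delta>) * (\<delta> * real T0)" using True by (intro mult_left_mono) auto
    then have "real T0 * (1 - 2 * \<delta>) \<le> (1 - \<delta>) * (real T0 - 1)"
      using mult_nonneg_nonneg[of "\<delta> * \<delta>" "real T0"] by (simp add: algebra_simps)
    then have "real T0 * (1 - 2 * \<delta>) * ?opt \<le> (1 - \<delta>) * (real T0 - 1) * ?opt"
      using opt by (rule mult_right_mono)
    with 1 have "real T0 * ((1 - 2 * \<delta>) * ?opt) \<le> real T0 * M" by (simp add: mult.assoc)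
    then show ?thesis using assms(4) by simp
  next
    case False
    have "(1 - 2 * \<delta>) * ?opt \<le> (1 - \<delta>) * ?opt"
      using opt assms(2) by (intro mult_right_mono) auto
    also have "\<dots> \<le> (1 - \<delta>) * real_of_rat (block_opts I T0 1)"
      using block_opts_le[OF assms(1,4)] False by (intro mult_left_mono_neg) (simp_all add: of_rat_less_eq)
    also have "\<dots> \<le> M" using M assms(4) by simp
    finally show ?thesis .
  qed
qed

text \<open>The left side is the cost of the whole program when each subroutine call costs at most
  \<open>K * n ^ d\<close>. The call term has degree \<open>d + 1\<close> in \<open>N\<close> and
  the value computations have degree 2, so \<open>d + 2\<close> dominates both even for
  \<open>d = 0\<close>. The 540 collects 300 from the terms linear in \<open>T\<close>, 120 from
  \<open>T * n\<close> and 120 from the constants.\<close>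

lemma run_time_bound:
  fixes T n N K T0 d :: nat
  assumes "T \<le> N" "n \<le> N" "1 \<le> N"
  shows "T0 * (T * (K * n ^ d + 100 * T0 + 100) + 30 + 2 * (T * (60 * n + 100) + 10) + 70) + 20
    \<le> (T0 * (K + 100 * T0 + 540) + 20) * N ^ (d + 2)"
proof -
  let ?M = "N ^ (d + 2)"
  have M1: "1 \<le> ?M" using assms(3) by simp
  have "N ^ 1 \<le> ?M" "N ^ 2 \<le> ?M" "N ^ (d + 1) \<le> ?M" using assms(3) by (intro power_increasing; simp)+
  moreover have "T * n \<le> N ^ 2" unfolding power2_eq_square using assms by (intro mult_mono) auto
  moreover have "T * n ^ d \<le> N * N ^ d" using assms by (intro mult_mono power_mono) auto
  then have "T * n ^ d \<le> N ^ (d + 1)" by simp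
  ultimately have M: "T \<le> ?M" "T * n \<le> ?M" "T * n ^ d \<le> ?M"
    using assms(1) unfolding power_one_right by linarith+
  have "T * (K * n ^ d + 100 * T0 + 100) + 30 + 2 * (T * (60 * n + 100) + 10) + 70
      = K * (T * n ^ d) + (100 * T0 + 300) * T + 120 * (T * n) + 120" by (simp add: algebra_simps)
  also have "\<dots> \<le> K * ?M + (100 * T0 + 300) * ?M + 120 * ?M + 120 * ?M"
    using M M1 by (intro add_mono mult_le_mono2) auto
  also have "\<dots> = (K + 100 * T0 + 540) * ?M" by (simp add: algebra_simps)
  finally have "T0 * (T * (K * n ^ d + 100 * T0 + 100) + 30 + 2 * (T * (60 * n + 100) + 10) + 70)
      \<le> T0 * ((K + 100 * T0 + 540) * ?M)" by (rule mult_le_mono2)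
  then have "T0 * (T * (K * n ^ d + 100 * T0 + 100) + 30 + 2 * (T * (60 * n + 100) + 10) + 70) + 20
      \<le> T0 * ((K + 100 * T0 + 540) * ?M) + 20 * ?M"
    by (rule add_mono) (use M1 in simp)
  then show ?thesis by (simp only: add_mult_distrib mult.assoc)
qed

text \<open>Constant and exponent of the hypothesis are arbitrary reals, possibly negative; for
  \<open>n \<ge> 1\<close>, rounding both up to natural numbers can only enlarge the bound.\<close>

lemma powr_le_power:
  fixes n :: nat
  assumes "1 \<le> n"
  shows "c * real n powr p \<le> real (nat \<lceil>c\<rceil> * n ^ nat \<lceil>p\<rceil>)"
proof -
  have "c * real n powr p \<le> real (nat \<lceil>c\<rceil>) * real n powr p"
    by (intro mult_right_mono) (simp_all add: real_nat_ceiling_ge)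
  also have "\<dots> \<le> real (nat \<lceil>c\<rceil>) * real n powr real (nat \<lceil>p\<rceil>)"
    using assms by (intro mult_left_mono powr_mono) (simp_all add: real_nat_ceiling_ge)
  also have "\<dots> = real (nat \<lceil>c\<rceil> * n ^ nat \<lceil>p\<rceil>)"
    using assms by (simp add: powr_realpow)
  finally show ?thesis .
qed

text \<open>\<open>Q\<close> is constrained only on instances with the same number of objects as
  \<open>I\<close>, so that \<open>D\<close> may depend on that number and still be a single bound
  for all blocks.\<close>

lemma ptas_prog_correct:
  assumes I: "mk_instance I" and "0 < \<delta>" "1 / \<delta> \<le> real T0" and T0: "T0 \<ge> 1"
    and Q: "\<And>I'. mk_instance I' \<Longrightarrow> horizon I' \<le> T0 \<Longrightarrow> nobj I' = nobj I \<Longrightarrow>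
      \<exists>S. (\<exists>\<tau>\<le>D. outputs Q I' S \<tau>) \<and> feasible I' S
        \<and> (1 - \<delta>) * real_of_rat (mk_opt I') \<le> real_of_rat (mk_value I' S)"
  obtains S \<tau> where "outputs (ptas_prog Q T0) I S \<tau>" "best_concat Q T0 I S" "feasible I S"
    "(1 - 2 * \<delta>) * real_of_rat (mk_opt I) \<le> real_of_rat (mk_value I S)"
    "\<tau> \<le> T0 * (horizon I * (D + 100 * T0 + 100) + 30 + 2 * (horizon I * (60 * nobj I + 100) + 10) + 70) + 20"
proof -
  have "\<exists>S. (\<exists>\<tau>\<le>D. outputs Q (block I T0 j) S \<tau>) \<and> feasible (block I T0 j) S
      \<and> (1 - \<delta>) * real_of_rat (mk_opt (block I T0 j)) \<le> real_of_rat (mk_value (block I T0 j) S)"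
    if "window I T0 j \<noteq> {}" for j
    by (rule Q) (simp_all add: mk_instance_block[OF I that] card_window_le)
  \<comment> \<open>One family of subroutine outputs, indexed by the start of the window, serves all
    offsets.\<close>
  then obtain F where F: "\<And>j. window I T0 j \<noteq> {} \<Longrightarrow>
      (\<exists>\<tau>\<le>D. outputs Q (block I T0 j) (F j) \<tau>) \<and> feasible (block I T0 j) (F j)
      \<and> (1 - \<delta>) * real_of_rat (mk_opt (block I T0 j)) \<le> real_of_rat (mk_value (block I T0 j) (F j))"
    by metis
  define Ss where "Ss t = glue I T0 t F" for t
  have out: "\<exists>\<tau>\<le>D. outputs Q (block I T0 j) (shift_sol (window I T0 j) (Ss t)) \<tau>"
    if "j \<in> block_starts I T0 t" for j t
    using F that outputs_glue[OF T0 that] unfolding Ss_def block_starts_def by blast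
  have feas: "feasible I (Ss t)" for t
    unfolding feasible_iff_blocks[OF T0, of I "Ss t" t]
    using F feasible_glue[OF T0, of _ I t F] unfolding Ss_def block_starts_def by blast
  then have sel: "selection I (Ss t)" for t unfolding feasible_def by blast
  have ratio: "(1 - \<delta>) * real_of_rat (block_opts I T0 t) \<le> real_of_rat (mk_value I (Ss t))" for t
  proof -
    have "(1 - \<delta>) * real_of_rat (block_opts I T0 t)
        = (\<Sum>j\<in>block_starts I T0 t. (1 - \<delta>) * real_of_rat (mk_opt (block I T0 j)))"
      unfolding block_opts_def by (simp add: of_rat_sum sum_distrib_left)
    also have "\<dots> \<le> (\<Sum>j\<in>block_starts I T0 t.
        real_of_rat (mk_value (block I T0 j) (shift_sol (window I T0 j) (Ss t))))"
    proof (rule sum_mono)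
      fix j assume j: "j \<in> block_starts I T0 t"
      then show "(1 - \<delta>) * real_of_rat (mk_opt (block I T0 j))
          \<le> real_of_rat (mk_value (block I T0 j) (shift_sol (window I T0 j) (Ss t)))"
        using F mk_value_glue[OF T0 j] unfolding Ss_def block_starts_def by simp
    qed
    also have "\<dots> \<le> real_of_rat (mk_value I (Ss t))"
      using block_values_le[OF I T0 sel, of t t] by (simp only: of_rat_less_eq flip: of_rat_sum)
    finally show ?thesis .
  qed
  let ?st = "list_val (map (step_val I) [1..<horizon I + 1])"
    and ?bo = "list_val (map (\<lambda>t. row_val I (bonus I t)) [1..<horizon I])"
  let ?C = "horizon I * (D + 100 * T0 + 100) + 30"
  have "call_within (ptas_prog Q T0) ''candidate'' [Num (of_nat t), ?st, ?bo] (sol_val I (Ss t)) ?C"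
    if "t \<in> {1..T0}" for t
    using that out by (rule call_candidate)
  note call_best[where m = T0, OF sel this refl refl T0]
  then obtain t where t: "t \<in> {1..T0}" "\<forall>t'\<in>{1..T0}. mk_value I (Ss t') \<le> mk_value I (Ss t)"
    and best: "call_within (ptas_prog Q T0) ''best''
      [Num (of_nat T0), ?st, ?bo] (sol_val I (Ss t))
      (T0 * (?C + 2 * (horizon I * (60 * nobj I + 100) + 10) + 70))"
    by blast
  obtain \<tau> where \<tau>: "\<tau> \<le> T0 * (horizon I * (D + 100 * T0 + 100) + 30
      + 2 * (horizon I * (60 * nobj I + 100) + 10) + 70) + 20"
    "exec (ptas_prog Q T0) (inst_val I) (sol_val I (Ss t)) \<tau>"
    using exec_main[OF best] unfolding inst_val_def by blast
  have "concat_sol Q T0 I t' (Ss t')" for t'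
    unfolding concat_sol_def using out unfolding block_starts_def by blast
  then have "best_concat Q T0 I (Ss t)"
    unfolding best_concat_def using t by blast
  moreover have "outputs (ptas_prog Q T0) I (Ss t) \<tau>"
    unfolding outputs_def using sel \<tau>(2) by blast
  moreover have "(1 - 2 * \<delta>) * real_of_rat (mk_opt I) \<le> real_of_rat (mk_value I (Ss t))"
  proof (rule approximation_ratio[OF I assms(2-4)])
    fix t' assume "t' \<in> {1..T0}"
    then show "(1 - \<delta>) * real_of_rat (block_opts I T0 t') \<le> real_of_rat (mk_value I (Ss t))"
      using ratio[of t'] t(2) by (meson of_rat_less_eq order_trans)
  qed
  ultimately show ?thesis using that feas \<tau>(1) by blast
qed

theorem theorem5:
  fixes A :: "real \<Rightarrow> nat \<Rightarrow> prog" and f :: "real \<Rightarrow> nat \<Rightarrow> real"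
  assumes A: "\<And>\<epsilon> T0. \<epsilon> > 0 \<Longrightarrow> T0 \<ge> 1 \<Longrightarrow>
    \<exists>c::real. \<forall>I. mk_instance I \<and> horizon I \<le> T0 \<longrightarrow>
      (\<exists>S \<tau>. outputs (A \<epsilon> T0) I S \<tau> \<and> feasible I S
         \<and> real_of_rat (mk_value I S) \<ge> (1 - \<epsilon>) * real_of_rat (mk_opt I)
         \<and> real \<tau> \<le> c * real (nobj I) powr f \<epsilon> T0)"
  shows "\<forall>\<epsilon>>0. \<exists>(c::real) (d::nat). \<forall>I. mk_instance I \<longrightarrow>
      (\<exists>S \<tau>. outputs (PTAS_MK A \<epsilon>) I S \<tau>
         \<and> best_concat (A (eps' \<epsilon>) (block_len \<epsilon>)) (block_len \<epsilon>) I S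
         \<and> feasible I S
         \<and> real_of_rat (mk_value I S) \<ge> (1 - \<epsilon>) * real_of_rat (mk_opt I)
         \<and> real \<tau> \<le> c * real (val_size (inst_val I)) ^ d)"
proof (intro allI impI)
  fix \<epsilon> :: real assume \<epsilon>: "\<epsilon> > 0"
  let ?\<delta> = "eps' \<epsilon>" and ?T0 = "block_len \<epsilon>"
  have \<delta>: "0 < ?\<delta>" "\<epsilon> = 2 * ?\<delta>" using \<epsilon> unfolding eps'_def by simp_all
  have T0: "1 / ?\<delta> \<le> real ?T0" unfolding block_len_def by (rule real_nat_ceiling_ge)
  moreover have "0 < 1 / ?\<delta>" using \<delta>(1) by simp
  ultimately have T0': "1 \<le> ?T0" by linarith
  let ?Q = "A ?\<delta> ?T0"
  from A[OF \<delta>(1) T0'] obtain c where c: "\<And>I. mk_instance I \<Longrightarrow> horizon I \<le> ?T0 \<Longrightarrow>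
      \<exists>S \<tau>. outputs ?Q I S \<tau> \<and> feasible I S
        \<and> real_of_rat (mk_value I S) \<ge> (1 - ?\<delta>) * real_of_rat (mk_opt I)
        \<and> real \<tau> \<le> c * real (nobj I) powr f ?\<delta> ?T0"
    by blast
  \<comment> \<open>Both depend on \<epsilon> alone, so the polynomial is fixed before the instance
    is given.\<close>
  define K d where "K = nat \<lceil>c\<rceil>" and "d = nat \<lceil>f ?\<delta> ?T0\<rceil>"
  let ?C = "?T0 * (K + 100 * ?T0 + 540) + 20"
  have "\<exists>S \<tau>. outputs (PTAS_MK A \<epsilon>) I S \<tau> \<and> best_concat ?Q ?T0 I S \<and> feasible I S
      \<and> real_of_rat (mk_value I S) \<ge> (1 - \<epsilon>) * real_of_rat (mk_opt I)
      \<and> real \<tau> \<le> real ?C * real (val_size (inst_val I)) ^ (d + 2)" if I: "mk_instance I" for I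
  proof -
    have 1: "1 \<le> horizon I" "1 \<le> nobj I" using I unfolding mk_instance_def by simp_all
    have Q: "\<exists>S. (\<exists>\<tau>\<le>K * nobj I ^ d. outputs ?Q I' S \<tau>) \<and> feasible I' S
        \<and> (1 - ?\<delta>) * real_of_rat (mk_opt I') \<le> real_of_rat (mk_value I' S)"
      if I': "mk_instance I'" "horizon I' \<le> ?T0" "nobj I' = nobj I" for I'
    proof -
      obtain S \<tau> where S: "outputs ?Q I' S \<tau>" "feasible I' S"
        "(1 - ?\<delta>) * real_of_rat (mk_opt I') \<le> real_of_rat (mk_value I' S)"
        and "real \<tau> \<le> c * real (nobj I) powr f ?\<delta> ?T0"
        using c[OF I'(1,2)] I'(3) by auto
      then have "real \<tau> \<le> real (K * nobj I ^ d)"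
        using powr_le_power[OF 1(2), of c "f ?\<delta> ?T0"] unfolding K_def d_def by linarith
      then show ?thesis using S of_nat_le_iff by blast
    qed
    obtain S \<tau> where S: "outputs (ptas_prog ?Q ?T0) I S \<tau>" "best_concat ?Q ?T0 I S" "feasible I S"
      "(1 - 2 * ?\<delta>) * real_of_rat (mk_opt I) \<le> real_of_rat (mk_value I S)"
      and "\<tau> \<le> ?T0 * (horizon I * (K * nobj I ^ d + 100 * ?T0 + 100) + 30
        + 2 * (horizon I * (60 * nobj I + 100) + 10) + 70) + 20"
      using ptas_prog_correct[OF I \<delta>(1) T0 T0' Q] by blast
    then have "\<tau> \<le> ?C * val_size (inst_val I) ^ (d + 2)"
      using run_time_bound[OF horizon_le_size nobj_le_size[OF 1(1)]] 1 horizon_le_size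
      by (meson order_trans)
    then have "real \<tau> \<le> real ?C * real (val_size (inst_val I)) ^ (d + 2)"
      by (metis of_nat_le_iff of_nat_mult of_nat_power)
    then show ?thesis using S unfolding PTAS_MK_def \<delta>(2)[symmetric] by blast
  qed
  then show "\<exists>(c::real) (d::nat). \<forall>I. mk_instance I \<longrightarrow>
      (\<exists>S \<tau>. outputs (PTAS_MK A \<epsilon>) I S \<tau>
         \<and> best_concat (A (eps' \<epsilon>) (block_len \<epsilon>)) (block_len \<epsilon>) I S
         \<and> feasible I S
         \<and> real_of_rat (mk_value I S) \<ge> (1 - \<epsilon>) * real_of_rat (mk_opt I)
         \<and> real \<tau> \<le> c * real (val_size (inst_val I)) ^ d)"
    by blast
qed

end
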